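(* Let $\Omega$ be a composite surface with broken finite element spaces $V_h$, $h\in(0,h_0]$, and let $a_h$, $s_h$ and $A_h = a_h + s_h$ be the Nitsche form, the stabilization form and the stabilized form defined in the context, where the stabilization form is assumed to satisfy the inverse inequality $$h\,\| \nu_i\cdot\sigma_i(v)\|^2_{\partial\Omega_i\setminus\Gamma_N}\lesssim \|v\|_{a_i}^2+\|v\|_{s_{h,i}}^2,\qquad v\in V_{h,i},\ i\in\mathcal I_\Omega .$$ Then: (i) (Coercivity) For large enough penalty parameter $\beta$, there is a constant such that for all $v\in V_h$ it holds $$|||v|||_{A_h}^2\lesssim A_h(v,v).$$ (ii) (Continuity) There is a constant such that for $v,w\in V_h+V$ it holds $$a_h(v,w)\lesssim |||v|||_{a_h}\,|||w|||_{a_h}$$ and $$A_h(v,w)\lesssim |||v|||_{A_h}\,|||w|||_{A_h}.$$ Here $a\lesssim b$ means $a\le cb$ with a constant $c$ independent of the mesh size parameter $h$ (and of the functions $v,w$).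
   Context: **Composite surface.** $\Omega=\bigcup_{i\in\mathcal I_\Omega}\Omega_i$ is a finite union of smooth oriented surfaces $\Omega_i\subset\mathbb R^3$ with boundary. Each $\Omega_i$ is contained in a smooth closed embedded surface. Each $\partial\Omega_i$ consists of finitely many smooth curve segments and corner points, with exterior unit conormal $\nu_i$ (tangent to $\Omega_i$, normal to $\partial\Omega_i$). At each corner $x$ the left and right conormals satisfy $-1<C\le \nu^+(x)\cdot\nu^-(x)$ for a constant $C$. For $i\neq j$, $\Omega_i\cap\Omega_j$ is either empty or equals $\partial\Omega_i\cap\partial\Omega_j$ and is a point or a smooth curve segment (an interface curve). Any two surfaces are joined by a sequence of surfaces in which consecutive ones share a nonempty interface, and no surface shares only a point with the union of the others. The union of all pairwise interface curves is written as the union of non-overlapping interface curves $\Gamma_j$, $j\in\mathcal I_{\Gamma_I}$. For $j\in\mathcal I_{\Gamma_I}$, $\mathcal I_\Omega(j)\subseteq\mathcal I_\Omega$ is the set of indices of the surfaces sharing $\Gamma_j$ (possibly more than two). The boundary $\partial\Omega$ (boundary curves that are not interfaces) is decomposed as $\partial\Omega=\Gamma_N\cup\Gamma_D$, $\Gamma_N\cap\Gamma_D=\emptyset$, $\Gamma_D\ne\emptyset$ (Neumann and Dirichlet parts); $\nu$ denotes the exterior conormal there. **Flux.** $\nabla_\Omega$ is the tangential gradient, $\nabla_\Omega v = (I-n\otimes n)\nabla v$ with $n$ the unit normal. $\mu:\Omega\to\mathbb R$ satisfies $\mu|_{\Omega_i}=\mu_i\in C(\Omega_i)$ and $0<c\le\mu\le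 C$ for constants $c,C$. $\sigma(v)=\mu\nabla_\Omega v$ and $\sigma_i(v)=\mu_i\nabla_{\Omega_i}v$. For a function $v$ on $\Omega$, $v_i=v|_{\Omega_i}$. $(\cdot,\cdot)_\omega$ and $\|\cdot\|_\omega$ are the $L^2(\omega)$ inner product and norm. **Meshes and spaces.** The geometry is exactly represented. For each $i$ there is a quasi-uniform family of meshes $\mathcal K_{h,i}$, $h\in(0,h_0]$, with mesh parameter $h$, such that $\overline\Omega_i\subseteq\bigcup_{K\in\mathcal K_{h,i}}\overline K$ and $\mathrm{int}(\Omega_i)\cap\mathrm{int}(K)\ne\emptyset$ for all $K\in\mathcal K_{h,i}$ (so elements may be cut by $\partial\Omega_i$, and meshes of different surfaces need not match). $V_{h,i}$ is a finite element space of continuous functions on $\mathcal K_{h,i}$ whose restriction to each $K$ lies in $P_p(K)$, the full or tensor-product polynomials of degree $\le p$. $V_h=\bigoplus_{i\in\mathcal I_\Omega}V_{h,i}$, with no continuity required across interfaces. $V$ is the space $V_{g_D}$ of functions $v:\Omega\to\mathbb R$ such that $v_i\in H^1(\Omega_i)$ for all $i\in\mathcal I_\Omega$, $v_k=v_l$ on $\Gamma_j$ for all $k,l\in\mathcal I_\Omega(j)$ and $j\in\mathcal I_{\Gamma_I}$, and $v=g_D$ on $\Gamma_D$, where $g_D$ is the Dirichlet datum ($g_D=0$ included). **Average.** On each $\Gamma_j$, $\langle v\rangle=\sum_{k\in\mathcal I_\Omega(j)}\alpha_k v_k$ is a convex combination, $0\le\alpha_k\le1$, $\sum_{k\in\mathcal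 I_\Omega(j)}\alpha_k=1$. **Forms.** With a positive penalty parameter $\beta$, $$\begin{aligned}a_h(v,w)={}&\sum_{i\in\mathcal I_\Omega}(\sigma(v),\nabla_\Omega w)_{\Omega_i}-\sum_{j\in\mathcal I_{\Gamma_I}}\sum_{k\in\mathcal I_\Omega(j)}\big((\nu_k\cdot\sigma_k(v_k),w_k-\langle w\rangle)_{\Gamma_j}+(v_k-\langle v\rangle,\nu_k\cdot\sigma_k(w_k))_{\Gamma_j}\big)\\&+\sum_{j\in\mathcal I_{\Gamma_I}}\sum_{k\in\mathcal I_\Omega(j)}(\beta\mu_kh^{-1}(v_k-\langle v\rangle),w_k-\langle w\rangle)_{\Gamma_j}\\&-(\nu\cdot\sigma(v),w)_{\Gamma_D}-(v,\nu\cdot\sigma(w))_{\Gamma_D}+(\beta\mu h^{-1}v,w)_{\Gamma_D}.\end{aligned}$$ $s_h(v,w)=\sum_{i\in\mathcal I_\Omega}s_{h,i}(v,w)$, where each $s_{h,i}$ is a positive semidefinite bilinear form on $V_{h,i}$. $A_h(v,w)=a_h(v,w)+s_h(v,w)$. **Norms.** $\|v\|_{a_i}^2=(\sigma_i(v),\nabla v)_{\Omega_i}$, $\|v\|_{s_{h,i}}^2=s_{h,i}(v,v)$, $\|v\|_{s_h}^2=s_h(v,v)$, $$|||v|||_{a_h}^2=\sum_{i\in\mathcal I_\Omega}\|v\|_{a_i}^2+\sum_{j\in\mathcal I_{\Gamma_I}}\sum_{k\in\mathcal I_\Omega(j)}\big(h\|\nu_k\cdot\nabla_\Omega v_k\|_{\Gamma_j}^2+h^{-1}\|v_k-\langle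 v\rangle\|_{\Gamma_j}^2\big)+h\|\nu\cdot\nabla_\Omega v\|_{\Gamma_D}^2+h^{-1}\|v\|_{\Gamma_D}^2,$$ $$|||v|||_{A_h}^2=|||v|||_{a_h}^2+\|v\|_{s_h}^2.$$
   Formalization: Continuity is stated for those v, w in V_h+V whose traces and conormal derivatives on interfaces and Γ_D exist in L²; for A_h they must also lie in a linear space containing V_h on which s_h is defined and positive semidefinite; positive semidefinite forms are taken to be symmetric. *)

theory Defs
  imports "HOL-Analysis.Analysis"
begin

definition hausdorff_content :: "nat \<Rightarrow> real \<Rightarrow> (real^3) set \<Rightarrow> ennreal" where
  "hausdorff_content d \<delta> A =
     (INF C \<in> {C :: nat \<Rightarrow> (real^3) set. A \<subseteq> (\<Union>n. C n) \<and> (\<forall>n. bounded (C n) \<and> diameter (C n) \<le> \<delta>)}.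
        \<Sum>n. ennreal (unit_ball_vol (real d) / 2 ^ d * diameter (C n) ^ d))"

text \<open>The Hausdorff outer measure is a metric outer measure, hence countably additive on the
  Borel sets. It is used for \<open>d = 2\<close> (surface area) and \<open>d = 1\<close> (arc length); the content
  above is not meant for \<open>d = 0\<close>, where the empty set would count.\<close>

definition hausdorff_measure :: "nat \<Rightarrow> (real^3) measure" where
  "hausdorff_measure d =
     measure_of UNIV (sets borel) (\<lambda>A. SUP \<delta> \<in> {0<..}. hausdorff_content d \<delta> A)"

definition L2_on :: "nat \<Rightarrow> (real^3) set \<Rightarrow> (real^3 \<Rightarrow> 'b::{second_countable_topology,banach}) \<Rightarrow> bool" where
  "L2_on d \<omega> f \<longleftrightarrow> set_borel_measurable (hausdorff_measure d) \<omega> f \<and>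
     set_integrable (hausdorff_measure d) \<omega> (\<lambda>x. (norm (f x))\<^sup>2)"

definition L2_inner :: "nat \<Rightarrow> (real^3) set \<Rightarrow> (real^3 \<Rightarrow> 'b::euclidean_space) \<Rightarrow> (real^3 \<Rightarrow> 'b) \<Rightarrow> real" where
  "L2_inner d \<omega> f g = (LINT x:\<omega>|hausdorff_measure d. f x \<bullet> g x)"

definition L2_norm :: "nat \<Rightarrow> (real^3) set \<Rightarrow> (real^3 \<Rightarrow> 'b::euclidean_space) \<Rightarrow> real" where
  "L2_norm d \<omega> f = sqrt (L2_inner d \<omega> f f)"

text \<open>Only used for open \<open>U\<close>.\<close>

primrec Ck_on :: "nat \<Rightarrow> 'a::euclidean_space set \<Rightarrow> ('a \<Rightarrow> 'b::euclidean_space) \<Rightarrow> bool" where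
  "Ck_on 0 U f = continuous_on U f"
| "Ck_on (Suc k) U f = ((\<forall>x\<in>U. f differentiable (at x)) \<and>
     (\<forall>v. Ck_on k U (\<lambda>x. frechet_derivative f (at x) v)))"

definition smooth_on :: "'a::euclidean_space set \<Rightarrow> ('a \<Rightarrow> 'b::euclidean_space) \<Rightarrow> bool" where
  "smooth_on U f \<longleftrightarrow> (\<forall>k. Ck_on k U f)"

definition smooth_closed_surface :: "(real^3) set \<Rightarrow> bool" where
  "smooth_closed_surface S \<longleftrightarrow> compact S \<and> S \<noteq> {} \<and>
     (\<forall>x\<in>S. \<exists>U (\<phi> :: real^3 \<Rightarrow> real). open U \<and> x \<in> U \<and> smooth_on U \<phi> \<and>
        (\<forall>y\<in>U. frechet_derivative \<phi> (at y) \<noteq> (\<lambda>_. 0)) \<and> S \<inter> U = {y\<in>U. \<phi> y = 0})"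

text \<open>Velocities of curves in \<open>M\<close>. The curve need only be differentiable at \<open>0\<close>, so asking for
  \<open>c t \<in> M\<close> at all \<open>t\<close> instead of small \<open>t\<close> is no restriction.\<close>

definition tangent_space :: "(real^3) set \<Rightarrow> real^3 \<Rightarrow> (real^3) set" where
  "tangent_space M x = {v. \<exists>c :: real \<Rightarrow> real^3. c 0 = x \<and> (\<forall>t. c t \<in> M) \<and>
     (c has_vector_derivative v) (at 0)}"

definition smooth_curve :: "(real \<Rightarrow> real^3) \<Rightarrow> bool" where
  "smooth_curve \<gamma> \<longleftrightarrow> simple_path \<gamma> \<and>
     (\<exists>U. open U \<and> {0..1} \<subseteq> U \<and> smooth_on U \<gamma> \<and> (\<forall>t\<in>U. vector_derivative \<gamma> (at t) \<noteq> 0))"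

abbreviation surf_interior :: "(real^3) set \<Rightarrow> (real^3) set \<Rightarrow> (real^3) set" where
  "surf_interior S \<Omega> \<equiv> top_of_set S interior_of \<Omega>"

abbreviation surf_boundary :: "(real^3) set \<Rightarrow> (real^3) set \<Rightarrow> (real^3) set" where
  "surf_boundary S \<Omega> \<equiv> top_of_set S frontier_of \<Omega>"

text \<open>The last conjunct says that \<open>\<nu>\<close> is exterior: curves in the closed surface \<open>S\<close> that start in
  direction \<open>\<nu>\<close> leave \<open>\<Omega>\<close>. The vector \<open>\<nu>\<close> is unique wherever the boundary is smooth.\<close>

definition is_conormal :: "(real^3) set \<Rightarrow> (real^3) set \<Rightarrow> real^3 \<Rightarrow> real^3 \<Rightarrow> bool" where
  "is_conormal S \<Omega> x \<nu> \<longleftrightarrow> norm \<nu> = 1 \<and> \<nu> \<in> tangent_space S x \<and>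
     (\<forall>\<tau>\<in>tangent_space (surf_boundary S \<Omega>) x. \<nu> \<bullet> \<tau> = 0) \<and>
     (\<forall>c. c 0 = x \<and> (\<forall>t. c t \<in> S) \<and> (c has_vector_derivative \<nu>) (at 0) \<longrightarrow>
        (\<forall>\<^sub>F t in at_right (0::real). c t \<notin> \<Omega>))"

definition conormal :: "(real^3) set \<Rightarrow> (real^3) set \<Rightarrow> real^3 \<Rightarrow> real^3" where
  "conormal S \<Omega> x = (THE \<nu>. is_conormal S \<Omega> x \<nu>)"

text \<open>Every end point of a boundary segment is treated as a corner; where two segments join
  smoothly, the one-sided conormals coincide and the angle condition is vacuous. A closed
  boundary curve may be given as one segment, which then contributes both of its ends.\<close>

definition piecewise_smooth_boundary :: "(real^3) set \<Rightarrow> (real^3) set \<Rightarrow> bool" where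
  "piecewise_smooth_boundary S \<Omega> \<longleftrightarrow> (\<exists>B. finite B \<and> (\<forall>\<gamma>\<in>B. smooth_curve \<gamma>) \<and>
     surf_boundary S \<Omega> = (\<Union>\<gamma>\<in>B. path_image \<gamma>) \<and>
     (\<forall>\<gamma>\<in>B. \<forall>\<gamma>'\<in>B. \<gamma> \<noteq> \<gamma>' \<longrightarrow> \<gamma> ` {0<..<1} \<inter> path_image \<gamma>' = {}) \<and>
     (\<forall>\<gamma>\<in>B. \<forall>e\<in>{0,1}. card {(\<gamma>', e'). \<gamma>' \<in> B \<and> e' \<in> {0,1} \<and> \<gamma>' e' = \<gamma> e} = 2) \<and>
     (\<exists>C>-1. \<forall>\<gamma>\<in>B. \<forall>\<gamma>'\<in>B. \<forall>e\<in>{0,1}. \<forall>e'\<in>{0,1}. \<forall>\<nu> \<nu>'.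
        (\<gamma>, e) \<noteq> (\<gamma>', e') \<and> \<gamma> e = \<gamma>' e' \<and>
        ((\<lambda>t. conormal S \<Omega> (\<gamma> t)) \<longlongrightarrow> \<nu>) (at e within {0..1}) \<and>
        ((\<lambda>t. conormal S \<Omega> (\<gamma>' t)) \<longlongrightarrow> \<nu>') (at e' within {0..1}) \<longrightarrow> C \<le> \<nu> \<bullet> \<nu>'))"

definition oriented_surface_in :: "(real^3) set \<Rightarrow> (real^3) set \<Rightarrow> (real^3 \<Rightarrow> real^3) \<Rightarrow> bool" where
  "oriented_surface_in S \<Omega> n \<longleftrightarrow> smooth_closed_surface S \<and> \<Omega> \<subseteq> S \<and> \<Omega> \<noteq> {} \<and>
     \<Omega> = top_of_set S closure_of (surf_interior S \<Omega>) \<and>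
     piecewise_smooth_boundary S \<Omega> \<and>
     continuous_on \<Omega> n \<and> (\<forall>x\<in>\<Omega>. norm (n x) = 1 \<and> (\<forall>\<tau>\<in>tangent_space S x. n x \<bullet> \<tau> = 0))"

definition tangent_proj :: "real^3 \<Rightarrow> real^3 \<Rightarrow> real^3" where
  "tangent_proj n b = b - (n \<bullet> b) *\<^sub>R n"

definition surf_div :: "(real^3 \<Rightarrow> real^3) \<Rightarrow> (real^3 \<Rightarrow> real^3) \<Rightarrow> real^3 \<Rightarrow> real" where
  "surf_div n \<phi> x = (\<Sum>b\<in>Basis. frechet_derivative \<phi> (at x) (tangent_proj (n x) b) \<bullet> b)"

text \<open>Weak tangential gradient: because the test fields are tangential, the integration by
  parts formula has no curvature term. For smooth \<open>v\<close> it yields \<open>tangent_proj n (\<nabla>v)\<close>.\<close>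

definition has_tangential_gradient ::
  "(real^3) set \<Rightarrow> (real^3) set \<Rightarrow> (real^3 \<Rightarrow> real^3) \<Rightarrow> (real^3 \<Rightarrow> real) \<Rightarrow> (real^3 \<Rightarrow> real^3) \<Rightarrow> bool" where
  "has_tangential_gradient S \<Omega> n v g \<longleftrightarrow> L2_on 2 \<Omega> v \<and> L2_on 2 \<Omega> g \<and>
     (AE x in hausdorff_measure 2. x \<in> \<Omega> \<longrightarrow> n x \<bullet> g x = 0) \<and>
     (\<forall>\<phi>. smooth_on UNIV \<phi> \<and> (\<forall>x\<in>\<Omega>. n x \<bullet> \<phi> x = 0) \<and>
          closure {x. \<phi> x \<noteq> 0} \<inter> surf_boundary S \<Omega> = {} \<longrightarrow>
          L2_inner 2 \<Omega> v (surf_div n \<phi>) = - L2_inner 2 \<Omega> g \<phi>)"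

definition H1 :: "(real^3) set \<Rightarrow> (real^3) set \<Rightarrow> (real^3 \<Rightarrow> real^3) \<Rightarrow> (real^3 \<Rightarrow> real) set" where
  "H1 S \<Omega> n = {v. \<exists>g. has_tangential_gradient S \<Omega> n v g}"

text \<open>Unique up to null sets.\<close>

definition tangential_gradient ::
  "(real^3) set \<Rightarrow> (real^3) set \<Rightarrow> (real^3 \<Rightarrow> real^3) \<Rightarrow> (real^3 \<Rightarrow> real) \<Rightarrow> real^3 \<Rightarrow> real^3" where
  "tangential_gradient S \<Omega> n v = (SOME g. has_tangential_gradient S \<Omega> n v g)"

text \<open>Boundary value of an integrable function as limit of averages over \<open>\<Omega>\<close>. It is the Sobolev
  trace if \<open>f\<close> is an \<open>H1\<close> function, it is \<open>f x\<close> if \<open>f\<close> is continuous, and it is also meaningful for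
  the gradients of finite element functions, which are only piecewise continuous.\<close>

definition has_boundary_value :: "(real^3) set \<Rightarrow> (real^3 \<Rightarrow> real) \<Rightarrow> real^3 \<Rightarrow> real \<Rightarrow> bool" where
  "has_boundary_value \<Omega> f x a \<longleftrightarrow>
     ((\<lambda>r. (LINT y:\<Omega> \<inter> ball x r|hausdorff_measure 2. \<bar>f y - a\<bar>)
           / measure (hausdorff_measure 2) (\<Omega> \<inter> ball x r)) \<longlongrightarrow> 0) (at_right 0)"

definition boundary_value :: "(real^3) set \<Rightarrow> (real^3 \<Rightarrow> real) \<Rightarrow> real^3 \<Rightarrow> real" where
  "boundary_value \<Omega> f x = (THE a. has_boundary_value \<Omega> f x a)"

text \<open>\<open>ambient\<close> is the closed surface containing the piece, and \<open>weight\<close> holds the coefficients of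
  the convex combination that defines the average on an interface.\<close>

record ('i, 'j) composite =
  surfs :: "'i set"
  ambient :: "'i \<Rightarrow> (real^3) set"
  piece :: "'i \<Rightarrow> (real^3) set"
  nrml :: "'i \<Rightarrow> real^3 \<Rightarrow> real^3"
  ifaces :: "'j set"
  iface_param :: "'j \<Rightarrow> real \<Rightarrow> real^3"
  dirichlet :: "(real^3) set"
  neumann :: "(real^3) set"
  coeff :: "'i \<Rightarrow> real^3 \<Rightarrow> real"
  weight :: "'j \<Rightarrow> 'i \<Rightarrow> real"

definition iface :: "('i, 'j) composite \<Rightarrow> 'j \<Rightarrow> (real^3) set" where
  "iface P j = path_image (iface_param P j)"

definition bdry :: "('i, 'j) composite \<Rightarrow> 'i \<Rightarrow> (real^3) set" where
  "bdry P i = surf_boundary (ambient P i) (piece P i)"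

definition sharing :: "('i, 'j) composite \<Rightarrow> 'j \<Rightarrow> 'i set" where
  "sharing P j = {i \<in> surfs P. iface P j \<subseteq> piece P i}"

definition outer_boundary :: "('i, 'j) composite \<Rightarrow> (real^3) set" where
  "outer_boundary P = (\<Union>i\<in>surfs P. bdry P i) - (\<Union>j\<in>ifaces P. iface P j)"

text \<open>The union of the interfaces omits pairwise intersections that are single points. The
  finiteness condition says that an interface is shared as a whole or not at all.\<close>

definition composite_surface :: "('i, 'j) composite \<Rightarrow> bool" where
  "composite_surface P \<longleftrightarrow>
     finite (surfs P) \<and> finite (ifaces P) \<and>
     (\<forall>i\<in>surfs P. oriented_surface_in (ambient P i) (piece P i) (nrml P i)) \<and>
     (\<forall>i\<in>surfs P. \<forall>k\<in>surfs P. i \<noteq> k \<and> piece P i \<inter> piece P k \<noteq> {} \<longrightarrow>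
        piece P i \<inter> piece P k = bdry P i \<inter> bdry P k \<and>
        ((\<exists>x. piece P i \<inter> piece P k = {x}) \<or>
         (\<exists>\<gamma>. smooth_curve \<gamma> \<and> piece P i \<inter> piece P k = path_image \<gamma>))) \<and>
     (\<forall>i\<in>surfs P. \<forall>k\<in>surfs P.
        (i, k) \<in> {(l, m). l \<in> surfs P \<and> m \<in> surfs P \<and> piece P l \<inter> piece P m \<noteq> {}}\<^sup>*) \<and>
     (\<forall>i\<in>surfs P. \<nexists>x. piece P i \<inter> (\<Union>k\<in>surfs P - {i}. piece P k) = {x}) \<and>
     (\<forall>j\<in>ifaces P. smooth_curve (iface_param P j)) \<and>
     (\<Union>j\<in>ifaces P. iface P j) =
        \<Union>{piece P i \<inter> piece P k | i k. i \<in> surfs P \<and> k \<in> surfs P \<and> i \<noteq> k \<and>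
              (\<nexists>x. piece P i \<inter> piece P k = {x})} \<and>
     (\<forall>j\<in>ifaces P. \<forall>l\<in>ifaces P. j \<noteq> l \<longrightarrow>
        iface_param P j ` {0<..<1} \<inter> iface_param P l ` {0<..<1} = {}) \<and>
     (\<forall>j\<in>ifaces P. \<forall>i\<in>surfs P - sharing P j. finite (iface P j \<inter> piece P i)) \<and>
     dirichlet P \<in> sets borel \<and> neumann P \<in> sets borel \<and>
     outer_boundary P = neumann P \<union> dirichlet P \<and> neumann P \<inter> dirichlet P = {} \<and> dirichlet P \<noteq> {}"

definition coefficient_bounds :: "('i, 'j) composite \<Rightarrow> bool" where
  "coefficient_bounds P \<longleftrightarrow> (\<forall>i\<in>surfs P. continuous_on (piece P i) (coeff P i)) \<and>
     (\<exists>c C. 0 < c \<and> (\<forall>i\<in>surfs P. \<forall>x\<in>piece P i. c \<le> coeff P i x \<and> coeff P i x \<le> C))"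

definition convex_weights :: "('i, 'j) composite \<Rightarrow> bool" where
  "convex_weights P \<longleftrightarrow> (\<forall>j\<in>ifaces P.
     (\<forall>k\<in>sharing P j. 0 \<le> weight P j k \<and> weight P j k \<le> 1) \<and> (\<Sum>k\<in>sharing P j. weight P j k) = 1)"

text \<open>A function on the composite surface is the family of its components \<open>v i\<close>; only the values
  of \<open>v i\<close> on \<open>piece P i\<close> (for finite element functions: on the mesh of this piece) matter.\<close>

type_synonym 'i field = "'i \<Rightarrow> real^3 \<Rightarrow> real"

definition grad :: "('i, 'j) composite \<Rightarrow> 'i \<Rightarrow> (real^3 \<Rightarrow> real) \<Rightarrow> real^3 \<Rightarrow> real^3" where
  "grad P i = tangential_gradient (ambient P i) (piece P i) (nrml P i)"

definition piece_trace :: "('i, 'j) composite \<Rightarrow> 'i \<Rightarrow> (real^3 \<Rightarrow> real) \<Rightarrow> real^3 \<Rightarrow> real" where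
  "piece_trace P i v = boundary_value (piece P i) v"

definition nu :: "('i, 'j) composite \<Rightarrow> 'i \<Rightarrow> real^3 \<Rightarrow> real^3" where
  "nu P i = conormal (ambient P i) (piece P i)"

definition conormal_deriv :: "('i, 'j) composite \<Rightarrow> 'i \<Rightarrow> (real^3 \<Rightarrow> real) \<Rightarrow> real^3 \<Rightarrow> real" where
  "conormal_deriv P i v x = boundary_value (piece P i) (\<lambda>y. nu P i x \<bullet> grad P i v y) x"

definition conormal_flux :: "('i, 'j) composite \<Rightarrow> 'i \<Rightarrow> (real^3 \<Rightarrow> real) \<Rightarrow> real^3 \<Rightarrow> real" where
  "conormal_flux P i v x = coeff P i x * conormal_deriv P i v x"

definition H1_piece :: "('i, 'j) composite \<Rightarrow> 'i \<Rightarrow> (real^3 \<Rightarrow> real) set" where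
  "H1_piece P i = H1 (ambient P i) (piece P i) (nrml P i)"

text \<open>The functions for which the boundary terms in the mesh dependent norm are defined and
  finite. For the trace this holds for all \<open>H1\<close> functions; for the conormal derivative it is a
  genuine regularity requirement.\<close>

definition energy_space :: "('i, 'j) composite \<Rightarrow> 'i \<Rightarrow> (real^3 \<Rightarrow> real) set" where
  "energy_space P i = {v \<in> H1_piece P i.
     (AE x in hausdorff_measure 1. x \<in> bdry P i - neumann P \<longrightarrow>
        (\<exists>a. has_boundary_value (piece P i) v x a) \<and>
        (\<exists>a. has_boundary_value (piece P i) (\<lambda>y. nu P i x \<bullet> grad P i v y) x a)) \<and>
     L2_on 1 (bdry P i - neumann P) (piece_trace P i v) \<and>
     L2_on 1 (bdry P i - neumann P) (conormal_deriv P i v)}"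

definition solution_space :: "('i, 'j) composite \<Rightarrow> (real^3 \<Rightarrow> real) \<Rightarrow> 'i field set" where
  "solution_space P g\<^sub>D = {v.
     (\<forall>i\<in>surfs P. v i \<in> H1_piece P i) \<and>
     (\<forall>j\<in>ifaces P. \<forall>k\<in>sharing P j. \<forall>l\<in>sharing P j.
        AE x in hausdorff_measure 1. x \<in> iface P j \<longrightarrow> piece_trace P k (v k) x = piece_trace P l (v l) x) \<and>
     (\<forall>i\<in>surfs P.
        AE x in hausdorff_measure 1. x \<in> dirichlet P \<inter> bdry P i \<longrightarrow> piece_trace P i (v i) x = g\<^sub>D x)}"

definition broken_space :: "('i, 'j) composite \<Rightarrow> ('i \<Rightarrow> (real^3 \<Rightarrow> real) set) \<Rightarrow> 'i field set" where
  "broken_space P X = {v. \<forall>i\<in>surfs P. v i \<in> X i}"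

definition field_sum :: "'i field set \<Rightarrow> 'i field set \<Rightarrow> 'i field set" where
  "field_sum X Y = {\<lambda>i x. v i x + w i x | v w. v \<in> X \<and> w \<in> Y}"

text \<open>Elements are images of the reference simplex or the reference cube in \<open>real^'d\<close>. For
  \<open>CARD('d) = 2\<close> they are (possibly curved) elements on the closed surface containing the piece, for
  \<open>CARD('d) = 3\<close> they are bulk elements cut by the piece.\<close>

datatype ('d::finite) element =
  Simplex (emap: "real^'d \<Rightarrow> real^3") | Cube (emap: "real^'d \<Rightarrow> real^3")

primrec ref :: "('d::finite) element \<Rightarrow> (real^'d) set" where
  "ref (Simplex F) = {x. (\<forall>i. 0 \<le> x $ i) \<and> (\<Sum>i\<in>UNIV. x $ i) \<le> 1}"
| "ref (Cube F) = {x. \<forall>i. 0 \<le> x $ i \<and> x $ i \<le> 1}"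

primrec exponents :: "nat \<Rightarrow> ('d::finite) element \<Rightarrow> ('d \<Rightarrow> nat) set" where
  "exponents p (Simplex F) = {m. (\<Sum>i\<in>UNIV. m i) \<le> p}"
| "exponents p (Cube F) = {m. \<forall>i. m i \<le> p}"

definition polynomial_on_element :: "nat \<Rightarrow> ('d::finite) element \<Rightarrow> (real^3 \<Rightarrow> real) \<Rightarrow> bool" where
  "polynomial_on_element p K v \<longleftrightarrow> (\<exists>c. \<forall>x\<in>ref K.
     v (emap K x) = (\<Sum>m\<in>exponents p K. c m * (\<Prod>i\<in>UNIV. (x $ i) ^ m i)))"

definition region :: "('d::finite) element \<Rightarrow> (real^3) set" where
  "region K = emap K ` ref K"

definition inner_region :: "('d::finite) element \<Rightarrow> (real^3) set" where
  "inner_region K = emap K ` interior (ref K)"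

definition mesh_of :: "(real^3) set \<Rightarrow> (real^3) set \<Rightarrow> ('d::finite) element set \<Rightarrow> bool" where
  "mesh_of S \<Omega> \<K> \<longleftrightarrow> finite \<K> \<and>
     (CARD('d) = 2 \<and> (\<forall>K\<in>\<K>. region K \<subseteq> S) \<or> CARD('d) = 3) \<and>
     (\<forall>K\<in>\<K>. \<exists>U. open U \<and> ref K \<subseteq> U \<and> smooth_on U (emap K)) \<and>
     (\<forall>K\<in>\<K>. \<forall>L\<in>\<K>. K \<noteq> L \<longrightarrow> inner_region K \<inter> inner_region L = {}) \<and>
     \<Omega> \<subseteq> (\<Union>K\<in>\<K>. region K) \<and>
     (\<forall>K\<in>\<K>. surf_interior S \<Omega> \<inter> inner_region K \<noteq> {})"

text \<open>The two-sided bound on the element maps expresses shape regularity together with element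
  diameters uniformly proportional to \<open>h\<close>.\<close>

definition quasi_uniform_meshes ::
  "(real^3) set \<Rightarrow> (real^3) set \<Rightarrow> real \<Rightarrow> (real \<Rightarrow> ('d::finite) element set) \<Rightarrow> bool" where
  "quasi_uniform_meshes S \<Omega> h\<^sub>0 \<K> \<longleftrightarrow> (\<forall>h\<in>{0<..h\<^sub>0}. mesh_of S \<Omega> (\<K> h)) \<and>
     (\<exists>c C. 0 < c \<and> (\<forall>h\<in>{0<..h\<^sub>0}. \<forall>K\<in>\<K> h. \<forall>x\<in>ref K. \<forall>y\<in>ref K.
        c * h * dist x y \<le> dist (emap K x) (emap K y) \<and>
        dist (emap K x) (emap K y) \<le> C * h * dist x y))"

definition linear_space :: "(real^3 \<Rightarrow> real) set \<Rightarrow> bool" where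
  "linear_space X \<longleftrightarrow> (\<lambda>_. 0) \<in> X \<and> (\<forall>v\<in>X. \<forall>w\<in>X. (\<lambda>x. v x + w x) \<in> X) \<and>
     (\<forall>a. \<forall>v\<in>X. (\<lambda>x. a * v x) \<in> X)"

text \<open>Functions on the mesh are extended by zero to have a unique representative.\<close>

definition fe_space :: "nat \<Rightarrow> ('d::finite) element set \<Rightarrow> (real^3 \<Rightarrow> real) set \<Rightarrow> bool" where
  "fe_space p \<K> X \<longleftrightarrow> linear_space X \<and>
     (\<forall>v\<in>X. continuous_on (\<Union>K\<in>\<K>. region K) v \<and> (\<forall>x. x \<notin> (\<Union>K\<in>\<K>. region K) \<longrightarrow> v x = 0) \<and>
        (\<forall>K\<in>\<K>. polynomial_on_element p K v))"

text \<open>Symmetry is part of positive semidefiniteness; without it \<open>s v v\<close> would not control \<open>s v w\<close>.\<close>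

definition psd_bilinear_form ::
  "(real^3 \<Rightarrow> real) set \<Rightarrow> ((real^3 \<Rightarrow> real) \<Rightarrow> (real^3 \<Rightarrow> real) \<Rightarrow> real) \<Rightarrow> bool" where
  "psd_bilinear_form X s \<longleftrightarrow>
     (\<forall>u\<in>X. \<forall>v\<in>X. \<forall>w\<in>X. \<forall>a. s (\<lambda>x. a * u x + v x) w = a * s u w + s v w) \<and>
     (\<forall>v\<in>X. \<forall>w\<in>X. s v w = s w v) \<and> (\<forall>v\<in>X. 0 \<le> s v v)"

definition average :: "('i, 'j) composite \<Rightarrow> 'j \<Rightarrow> 'i field \<Rightarrow> real^3 \<Rightarrow> real" where
  "average P j v x = (\<Sum>k\<in>sharing P j. weight P j k * piece_trace P k (v k) x)"

definition deviation :: "('i, 'j) composite \<Rightarrow> 'j \<Rightarrow> 'i \<Rightarrow> 'i field \<Rightarrow> real^3 \<Rightarrow> real" where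
  "deviation P j k v x = piece_trace P k (v k) x - average P j v x"

definition dir_part :: "('i, 'j) composite \<Rightarrow> 'i \<Rightarrow> (real^3) set" where
  "dir_part P i = dirichlet P \<inter> bdry P i"

text \<open>Integrals over the Dirichlet boundary are split into the parts on the individual pieces,
  which overlap in at most finitely many points.\<close>

definition a_form :: "('i, 'j) composite \<Rightarrow> real \<Rightarrow> real \<Rightarrow> 'i field \<Rightarrow> 'i field \<Rightarrow> real" where
  "a_form P \<beta> h v w =
     (\<Sum>i\<in>surfs P. L2_inner 2 (piece P i) (\<lambda>x. coeff P i x *\<^sub>R grad P i (v i) x) (grad P i (w i)))
   - (\<Sum>j\<in>ifaces P. \<Sum>k\<in>sharing P j.
        L2_inner 1 (iface P j) (conormal_flux P k (v k)) (deviation P j k w)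
      + L2_inner 1 (iface P j) (deviation P j k v) (conormal_flux P k (w k)))
   + (\<Sum>j\<in>ifaces P. \<Sum>k\<in>sharing P j.
        L2_inner 1 (iface P j) (\<lambda>x. \<beta> * coeff P k x * inverse h * deviation P j k v x) (deviation P j k w))
   - (\<Sum>i\<in>surfs P. L2_inner 1 (dir_part P i) (conormal_flux P i (v i)) (piece_trace P i (w i)))
   - (\<Sum>i\<in>surfs P. L2_inner 1 (dir_part P i) (piece_trace P i (v i)) (conormal_flux P i (w i)))
   + (\<Sum>i\<in>surfs P.
        L2_inner 1 (dir_part P i) (\<lambda>x. \<beta> * coeff P i x * inverse h * piece_trace P i (v i) x) (piece_trace P i (w i)))"

type_synonym 'i stabilization = "'i \<Rightarrow> (real^3 \<Rightarrow> real) \<Rightarrow> (real^3 \<Rightarrow> real) \<Rightarrow> real"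

definition s_form :: "('i, 'j) composite \<Rightarrow> 'i stabilization \<Rightarrow> 'i field \<Rightarrow> 'i field \<Rightarrow> real" where
  "s_form P s v w = (\<Sum>i\<in>surfs P. s i (v i) (w i))"

definition A_form :: "('i, 'j) composite \<Rightarrow> real \<Rightarrow> real \<Rightarrow> 'i stabilization \<Rightarrow> 'i field \<Rightarrow> 'i field \<Rightarrow> real" where
  "A_form P \<beta> h s v w = a_form P \<beta> h v w + s_form P s v w"

definition norm_a_piece :: "('i, 'j) composite \<Rightarrow> 'i \<Rightarrow> (real^3 \<Rightarrow> real) \<Rightarrow> real" where
  "norm_a_piece P i v = sqrt (L2_inner 2 (piece P i) (\<lambda>x. coeff P i x *\<^sub>R grad P i v x) (grad P i v))"

definition norm_a :: "('i, 'j) composite \<Rightarrow> real \<Rightarrow> 'i field \<Rightarrow> real" where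
  "norm_a P h v = sqrt (
     (\<Sum>i\<in>surfs P. (norm_a_piece P i (v i))\<^sup>2)
   + (\<Sum>j\<in>ifaces P. \<Sum>k\<in>sharing P j.
        h * (L2_norm 1 (iface P j) (conormal_deriv P k (v k)))\<^sup>2
      + inverse h * (L2_norm 1 (iface P j) (deviation P j k v))\<^sup>2)
   + h * (\<Sum>i\<in>surfs P. (L2_norm 1 (dir_part P i) (conormal_deriv P i (v i)))\<^sup>2)
   + inverse h * (\<Sum>i\<in>surfs P. (L2_norm 1 (dir_part P i) (piece_trace P i (v i)))\<^sup>2))"

definition norm_s_piece :: "'i stabilization \<Rightarrow> 'i \<Rightarrow> (real^3 \<Rightarrow> real) \<Rightarrow> real" where
  "norm_s_piece s i v = sqrt (s i v v)"

definition norm_s :: "('i, 'j) composite \<Rightarrow> 'i stabilization \<Rightarrow> 'i field \<Rightarrow> real" where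
  "norm_s P s v = sqrt (s_form P s v v)"

definition norm_A :: "('i, 'j) composite \<Rightarrow> real \<Rightarrow> 'i stabilization \<Rightarrow> 'i field \<Rightarrow> real" where
  "norm_A P h s v = sqrt ((norm_a P h v)\<^sup>2 + (norm_s P s v)\<^sup>2)"

end

theory Submission
  imports Defs
begin

text \<open>Both continuity estimates are termwise. Each term of the form is bounded by the Cauchy-Schwarz
  inequality with the coefficient as weight (\<open>weighted_Cauchy_Schwarz\<close>), and the powers of \<open>h\<close> in the
  energy norm are matched: a conormal derivative scaled by the square root of \<open>h\<close> meets a deviation or a
  trace scaled by the inverse square root. The number of terms is independent of \<open>h\<close>. The
  stabilization obeys the Cauchy-Schwarz inequality for semidefinite forms (\<open>psd_Cauchy_Schwarz\<close>).

  For coercivity (\<open>A_form_coercive\<close>) write \<open>E\<close> for the sum of the squared energy and stabilization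
  seminorms of the pieces, \<open>F\<close> for the sum of all squared conormal flux norms on interface sides and
  Dirichlet parts, scaled by \<open>h\<close>, and \<open>T\<close> for the sum of the squared norms of deviations and Dirichlet
  traces, scaled by \<open>1 / h\<close>. Young's inequality and the lower bound \<open>c\<close> for the coefficient give
  \<open>A_h(v, v) \<ge> E - \<delta> * F - T / \<delta> + \<beta> * c * T\<close>. Interfaces and Dirichlet parts lie in the boundary of
  their piece and avoid the Neumann part (\<open>iface_subset\<close>, \<open>dir_part_subset\<close>), so the inverse inequality
  yields \<open>F \<le> K * E\<close>, where \<open>K\<close> also accounts for the number of interface sides. With \<open>\<delta> = 1 / (2 * K)\<close>
  and \<open>\<beta> * c \<ge> 2 * K + 1\<close> this leaves \<open>E / 2 + T\<close>, which controls the full norm because conormal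
  derivatives are bounded by fluxes.\<close>

section \<open>Square integrable functions and weighted Cauchy-Schwarz inequalities\<close>

lemma abs_le_sqrt_mult_sqrt_of_quadratic_nonneg:
  fixes a b c :: real
  assumes q: "\<And>t. 0 \<le> t\<^sup>2 * a + 2 * t * b + c" and a: "0 \<le> a"
  shows "\<bar>b\<bar> \<le> sqrt a * sqrt c"
proof (cases "a = 0")
  case True
  have "b = 0"
  proof (rule ccontr)
    assume "b \<noteq> 0"
    \<comment> \<open>for \<open>a = 0\<close> the polynomial in \<open>t\<close> is affine, with value \<open>- 1\<close> at this point\<close>
    then show False using q[of "- (c + 1) / (2 * b)"] True by (simp add: field_simps)
  qed
  then show ?thesis using True by simp
next
  case False
  with a have a: "0 < a" by simp
  have "0 \<le> c - b\<^sup>2 / a"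
    using q[of "- b / a"] a by (simp add: power2_eq_square field_simps)
  then have "b\<^sup>2 \<le> a * c" using a by (simp add: field_simps)
  then have "sqrt (b\<^sup>2) \<le> sqrt (a * c)" by (rule real_sqrt_le_mono)
  then show ?thesis by (simp add: real_sqrt_mult)
qed

lemma sets_hausdorff_measure [simp, measurable_cong]: "sets (hausdorff_measure d) = sets borel"
  unfolding hausdorff_measure_def
  by (simp add: sets_measure_of sets.sigma_sets_eq[of borel, simplified])

lemma L2_inner_commute: "L2_inner d \<omega> f g = L2_inner d \<omega> g f"
  unfolding L2_inner_def by (simp add: inner_commute)

lemma L2_inner_self_nonneg: "0 \<le> L2_inner d \<omega> f f"
  unfolding L2_inner_def set_lebesgue_integral_def
  by (intro integral_nonneg_AE) (simp add: indicator_def)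

lemma L2_norm_nonneg: "0 \<le> L2_norm d \<omega> f"
  unfolding L2_norm_def by (simp add: L2_inner_self_nonneg)

lemma L2_norm_squared: "(L2_norm d \<omega> f)\<^sup>2 = L2_inner d \<omega> f f"
  unfolding L2_norm_def by (simp add: L2_inner_self_nonneg)

lemma L2_on_subset:
  assumes "L2_on d A f" "B \<in> sets borel" "B \<subseteq> A"
  shows "L2_on d B f"
  using assms unfolding L2_on_def
  by (auto intro: set_integrable_subset set_borel_measurable_subset)

lemma weighted_inner_integrable:
  fixes f g :: "real^3 \<Rightarrow> 'b::euclidean_space"
  assumes m: "set_borel_measurable (hausdorff_measure d) \<omega> m" "\<And>x. x \<in> \<omega> \<Longrightarrow> \<bar>m x\<bar> \<le> C"
    and f: "L2_on d \<omega> f" and g: "L2_on d \<omega> g"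
  shows "set_integrable (hausdorff_measure d) \<omega> (\<lambda>x. m x * (f x \<bullet> g x))"
proof -
  let ?M = "hausdorff_measure d"
  have b: "integrable ?M (\<lambda>x. C * (indicator \<omega> x *\<^sub>R (norm (f x))\<^sup>2 + indicator \<omega> x *\<^sub>R (norm (g x))\<^sup>2))"
    using f g unfolding L2_on_def set_integrable_def by auto
  have [measurable]: "(\<lambda>x. indicator \<omega> x *\<^sub>R m x) \<in> borel_measurable ?M"
      "(\<lambda>x. indicator \<omega> x *\<^sub>R f x) \<in> borel_measurable ?M"
      "(\<lambda>x. indicator \<omega> x *\<^sub>R g x) \<in> borel_measurable ?M"
    using m f g unfolding L2_on_def set_borel_measurable_def by auto
  have "(\<lambda>x. (indicator \<omega> x *\<^sub>R m x) * ((indicator \<omega> x *\<^sub>R f x) \<bullet> (indicator \<omega> x *\<^sub>R g x)))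
      \<in> borel_measurable ?M"
    by measurable
  also have "(\<lambda>x. (indicator \<omega> x *\<^sub>R m x) * ((indicator \<omega> x *\<^sub>R f x) \<bullet> (indicator \<omega> x *\<^sub>R g x)))
      = (\<lambda>x. indicator \<omega> x *\<^sub>R (m x * (f x \<bullet> g x)))"
    by (auto simp: indicator_def)
  finally have meas: "(\<lambda>x. indicator \<omega> x *\<^sub>R (m x * (f x \<bullet> g x))) \<in> borel_measurable ?M" .
  have bound: "\<bar>m x\<bar> * \<bar>f x \<bullet> g x\<bar> \<le> C * ((norm (f x))\<^sup>2 + (norm (g x))\<^sup>2)" if "x \<in> \<omega>" for x
  proof -
    have "\<bar>f x \<bullet> g x\<bar> \<le> norm (f x) * norm (g x)" by (rule Cauchy_Schwarz_ineq2)
    also have "\<dots> \<le> (norm (f x))\<^sup>2 + (norm (g x))\<^sup>2"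
      using sum_squares_bound[of "norm (f x)" "norm (g x)"]
        mult_nonneg_nonneg[OF norm_ge_zero[of "f x"] norm_ge_zero[of "g x"]] by linarith
    finally show ?thesis using m(2)[OF that] by (intro mult_mono) auto
  qed
  show ?thesis unfolding set_integrable_def
  proof (rule Bochner_Integration.integrable_bound[OF b meas], rule AE_I2)
    fix x
    show "norm (indicator \<omega> x *\<^sub>R (m x * (f x \<bullet> g x)))
      \<le> norm (C * (indicator \<omega> x *\<^sub>R (norm (f x))\<^sup>2 + indicator \<omega> x *\<^sub>R (norm (g x))\<^sup>2))"
      using order_trans[OF bound[of x] abs_ge_self]
      by (cases "x \<in> \<omega>") (simp_all add: abs_mult)
  qed
qed

lemma inner_integrable:
  fixes f g :: "real^3 \<Rightarrow> 'b::euclidean_space"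
  assumes f: "L2_on d \<omega> f" and g: "L2_on d \<omega> g" and \<omega>: "\<omega> \<in> sets borel"
  shows "set_integrable (hausdorff_measure d) \<omega> (\<lambda>x. f x \<bullet> g x)"
proof -
  have "set_borel_measurable (hausdorff_measure d) \<omega> (\<lambda>_. 1::real)"
    using \<omega> unfolding set_borel_measurable_def by simp
  from weighted_inner_integrable[OF this _ f g, of 1] show ?thesis by simp
qed

lemma weighted_Cauchy_Schwarz:
  fixes f g :: "real^3 \<Rightarrow> 'b::euclidean_space"
  assumes m: "set_borel_measurable (hausdorff_measure d) \<omega> m"
      "\<And>x. x \<in> \<omega> \<Longrightarrow> 0 \<le> m x" "\<And>x. x \<in> \<omega> \<Longrightarrow> m x \<le> C"
    and f: "L2_on d \<omega> f" and g: "L2_on d \<omega> g"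
  shows "\<bar>L2_inner d \<omega> (\<lambda>x. m x *\<^sub>R f x) g\<bar>
    \<le> sqrt (L2_inner d \<omega> (\<lambda>x. m x *\<^sub>R f x) f) * sqrt (L2_inner d \<omega> (\<lambda>x. m x *\<^sub>R g x) g)"
proof -
  let ?M = "hausdorff_measure d"
  have mC: "\<bar>m x\<bar> \<le> C" if "x \<in> \<omega>" for x using m(2,3)[OF that] by simp
  note int = weighted_inner_integrable[OF m(1) mC]
  have I: "set_integrable ?M \<omega> (\<lambda>x. m x * (f x \<bullet> f x))" "set_integrable ?M \<omega> (\<lambda>x. m x * (f x \<bullet> g x))"
      "set_integrable ?M \<omega> (\<lambda>x. m x * (g x \<bullet> g x))"
    by (intro int f g; assumption)+
  have nn: "0 \<le> (LINT x:\<omega>|?M. m x * (u x \<bullet> u x))" for u :: "real^3 \<Rightarrow> 'b"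
    unfolding set_lebesgue_integral_def
    by (intro integral_nonneg_AE AE_I2) (simp add: indicator_def m(2))
  have "0 \<le> t\<^sup>2 * (LINT x:\<omega>|?M. m x * (f x \<bullet> f x)) + 2 * t * (LINT x:\<omega>|?M. m x * (f x \<bullet> g x))
      + (LINT x:\<omega>|?M. m x * (g x \<bullet> g x))" for t
  proof -
    have "0 \<le> (LINT x:\<omega>|?M. m x * ((t *\<^sub>R f x + g x) \<bullet> (t *\<^sub>R f x + g x)))"
      by (rule nn)
    also have "\<dots> = (LINT x:\<omega>|?M. t\<^sup>2 * (m x * (f x \<bullet> f x)) + 2 * t * (m x * (f x \<bullet> g x))
        + m x * (g x \<bullet> g x))"
      by (simp add: inner_simps inner_commute power2_eq_square algebra_simps)
    also have "\<dots> = t\<^sup>2 * (LINT x:\<omega>|?M. m x * (f x \<bullet> f x)) + 2 * t * (LINT x:\<omega>|?M. m x * (f x \<bullet> g x))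
      + (LINT x:\<omega>|?M. m x * (g x \<bullet> g x))"
      using I by (simp add: set_integral_add set_integrable_mult_right)
    finally show ?thesis .
  qed
  from abs_le_sqrt_mult_sqrt_of_quadratic_nonneg[OF this nn] show ?thesis
    unfolding L2_inner_def by simp
qed

lemma weighted_inner_self_bounds:
  fixes f :: "real^3 \<Rightarrow> 'b::euclidean_space"
  assumes \<omega>: "\<omega> \<in> sets borel" and m: "set_borel_measurable (hausdorff_measure d) \<omega> m"
      "\<And>x. x \<in> \<omega> \<Longrightarrow> c \<le> m x" "\<And>x. x \<in> \<omega> \<Longrightarrow> m x \<le> C" and c: "0 \<le> c"
    and f: "L2_on d \<omega> f"
  shows "c * (L2_norm d \<omega> f)\<^sup>2 \<le> L2_inner d \<omega> (\<lambda>x. m x *\<^sub>R f x) f"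
    and "L2_inner d \<omega> (\<lambda>x. m x *\<^sub>R f x) f \<le> C * (L2_norm d \<omega> f)\<^sup>2"
proof -
  let ?M = "hausdorff_measure d"
  have mC: "\<bar>m x\<bar> \<le> C" if "x \<in> \<omega>" for x using m(2,3)[OF that] c by simp
  note I = weighted_inner_integrable[OF m(1) mC f f] inner_integrable[OF f f \<omega>]
  have "(LINT x:\<omega>|?M. c * (f x \<bullet> f x)) \<le> (LINT x:\<omega>|?M. m x * (f x \<bullet> f x))"
    by (rule set_integral_mono) (auto intro: I set_integrable_mult_right mult_right_mono m)
  moreover have "(LINT x:\<omega>|?M. m x * (f x \<bullet> f x)) \<le> (LINT x:\<omega>|?M. C * (f x \<bullet> f x))"
    by (rule set_integral_mono) (auto intro: I set_integrable_mult_right mult_right_mono m)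
  ultimately show "c * (L2_norm d \<omega> f)\<^sup>2 \<le> L2_inner d \<omega> (\<lambda>x. m x *\<^sub>R f x) f"
      "L2_inner d \<omega> (\<lambda>x. m x *\<^sub>R f x) f \<le> C * (L2_norm d \<omega> f)\<^sup>2"
    unfolding L2_norm_squared L2_inner_def by auto
qed

text \<open>The weight is absorbed into its upper bound, so that unweighted norms remain.\<close>

lemma weighted_Cauchy_Schwarz_bounded:
  fixes f g :: "real^3 \<Rightarrow> 'b::euclidean_space"
  assumes \<omega>: "\<omega> \<in> sets borel" and m: "set_borel_measurable (hausdorff_measure d) \<omega> m"
      "\<And>x. x \<in> \<omega> \<Longrightarrow> 0 \<le> m x" "\<And>x. x \<in> \<omega> \<Longrightarrow> m x \<le> C" and C: "0 \<le> C"
    and f: "L2_on d \<omega> f" and g: "L2_on d \<omega> g"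
  shows "\<bar>L2_inner d \<omega> (\<lambda>x. m x *\<^sub>R f x) g\<bar> \<le> C * (L2_norm d \<omega> f * L2_norm d \<omega> g)"
proof -
  have *: "sqrt (L2_inner d \<omega> (\<lambda>x. m x *\<^sub>R u x) u) \<le> sqrt C * L2_norm d \<omega> u"
    if "L2_on d \<omega> u" for u :: "real^3 \<Rightarrow> 'b"
    using real_sqrt_le_mono[OF weighted_inner_self_bounds(2)[OF \<omega> m _ that]]
    by (simp add: real_sqrt_mult L2_norm_nonneg)
  note weighted_Cauchy_Schwarz[OF m f g]
  also have "sqrt (L2_inner d \<omega> (\<lambda>x. m x *\<^sub>R f x) f) * sqrt (L2_inner d \<omega> (\<lambda>x. m x *\<^sub>R g x) g)
      \<le> (sqrt C * L2_norm d \<omega> f) * (sqrt C * L2_norm d \<omega> g)"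
    by (intro mult_mono * f g)
      (auto intro!: mult_nonneg_nonneg C L2_norm_nonneg real_sqrt_ge_zero integral_nonneg_AE
        simp: L2_inner_def set_lebesgue_integral_def indicator_def m)
  also have "\<dots> = (sqrt C * sqrt C) * (L2_norm d \<omega> f * L2_norm d \<omega> g)"
    by (simp only: mult_ac)
  also have "sqrt C * sqrt C = C" using C by simp
  finally show ?thesis .
qed

lemma L2_Cauchy_Schwarz:
  fixes f g :: "real^3 \<Rightarrow> 'b::euclidean_space"
  assumes \<omega>: "\<omega> \<in> sets borel" and f: "L2_on d \<omega> f" and g: "L2_on d \<omega> g"
  shows "\<bar>L2_inner d \<omega> f g\<bar> \<le> L2_norm d \<omega> f * L2_norm d \<omega> g"
proof -
  have "set_borel_measurable (hausdorff_measure d) \<omega> (\<lambda>_. 1::real)"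
    using \<omega> unfolding set_borel_measurable_def by simp
  from weighted_Cauchy_Schwarz_bounded[OF \<omega> this _ _ _ f g, of 1] show ?thesis by simp
qed

lemma L2_norm_squared_mono_set:
  fixes f :: "real^3 \<Rightarrow> 'b::euclidean_space"
  assumes f: "L2_on d A f" and B: "B \<in> sets borel" "B \<subseteq> A" and A: "A \<in> sets borel"
  shows "(L2_norm d B f)\<^sup>2 \<le> (L2_norm d A f)\<^sup>2"
  unfolding L2_norm_squared L2_inner_def set_lebesgue_integral_def
proof (rule integral_mono)
  show "integrable (hausdorff_measure d) (\<lambda>x. indicator B x *\<^sub>R (f x \<bullet> f x))"
    using inner_integrable[OF L2_on_subset[OF f B] L2_on_subset[OF f B] B(1)]
    by (simp add: set_integrable_def)
  show "integrable (hausdorff_measure d) (\<lambda>x. indicator A x *\<^sub>R (f x \<bullet> f x))"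
    using inner_integrable[OF f f A] by (simp add: set_integrable_def)
qed (use B in \<open>auto simp: indicator_def\<close>)

lemma L2_on_bounded_mult:
  assumes m: "set_borel_measurable (hausdorff_measure d) \<omega> m" "\<And>x. x \<in> \<omega> \<Longrightarrow> \<bar>m x\<bar> \<le> C"
    and f: "L2_on d \<omega> f"
  shows "L2_on d \<omega> (\<lambda>x. m x * f x :: real)"
proof -
  let ?M = "hausdorff_measure d"
  have [measurable]: "(\<lambda>x. indicator \<omega> x *\<^sub>R m x) \<in> borel_measurable ?M"
      "(\<lambda>x. indicator \<omega> x *\<^sub>R f x) \<in> borel_measurable ?M"
    using m f unfolding L2_on_def set_borel_measurable_def by auto
  have "(\<lambda>x. (indicator \<omega> x *\<^sub>R m x) * (indicator \<omega> x *\<^sub>R f x)) \<in> borel_measurable ?M"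
      "(\<lambda>x. (indicator \<omega> x *\<^sub>R m x) * (indicator \<omega> x *\<^sub>R m x)) \<in> borel_measurable ?M"
    by measurable
  moreover have "(\<lambda>x. (indicator \<omega> x *\<^sub>R m x) * (indicator \<omega> x *\<^sub>R f x))
      = (\<lambda>x. indicator \<omega> x *\<^sub>R (m x * f x))"
      "(\<lambda>x. (indicator \<omega> x *\<^sub>R m x) * (indicator \<omega> x *\<^sub>R m x)) = (\<lambda>x. indicator \<omega> x *\<^sub>R (m x)\<^sup>2)"
    by (auto simp: indicator_def power2_eq_square)
  ultimately have meas: "set_borel_measurable ?M \<omega> (\<lambda>x. m x * f x)"
      "set_borel_measurable ?M \<omega> (\<lambda>x. (m x)\<^sup>2)"
    unfolding set_borel_measurable_def by auto
  have "\<bar>(m x)\<^sup>2\<bar> \<le> C\<^sup>2" if "x \<in> \<omega>" for x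
    using power_mono[OF m(2)[OF that], of 2] by simp
  from weighted_inner_integrable[OF meas(2) this f f] meas(1) show ?thesis
    unfolding L2_on_def by (simp add: power2_eq_square mult_ac)
qed

lemma L2_on_add:
  fixes f g :: "real^3 \<Rightarrow> real"
  assumes \<omega>: "\<omega> \<in> sets borel" and f: "L2_on d \<omega> f" and g: "L2_on d \<omega> g"
  shows "L2_on d \<omega> (\<lambda>x. f x + g x)"
proof -
  let ?M = "hausdorff_measure d"
  have [measurable]: "(\<lambda>x. indicator \<omega> x *\<^sub>R f x) \<in> borel_measurable ?M"
      "(\<lambda>x. indicator \<omega> x *\<^sub>R g x) \<in> borel_measurable ?M"
    using f g unfolding L2_on_def set_borel_measurable_def by auto
  have "(\<lambda>x. indicator \<omega> x *\<^sub>R f x + indicator \<omega> x *\<^sub>R g x) \<in> borel_measurable ?M"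
    by measurable
  moreover have "set_integrable ?M \<omega> (\<lambda>x. f x * f x + (2 * (f x * g x) + g x * g x))"
    using inner_integrable[OF f f \<omega>] inner_integrable[OF f g \<omega>] inner_integrable[OF g g \<omega>]
    by (intro set_integral_add set_integrable_mult_right) auto
  ultimately show ?thesis
    unfolding L2_on_def set_borel_measurable_def
    by (simp add: scaleR_add_right power2_eq_square algebra_simps)
qed

lemma L2_on_const_mult:
  fixes f :: "real^3 \<Rightarrow> real"
  assumes "\<omega> \<in> sets borel" "L2_on d \<omega> f"
  shows "L2_on d \<omega> (\<lambda>x. a * f x)"
  using assms by (intro L2_on_bounded_mult[where C = "\<bar>a\<bar>"]) (auto simp: set_borel_measurable_def)

lemma L2_on_sum:
  fixes f :: "'k \<Rightarrow> real^3 \<Rightarrow> real"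
  assumes \<omega>: "\<omega> \<in> sets borel" and "finite K" "\<And>k. k \<in> K \<Longrightarrow> L2_on d \<omega> (f k)"
  shows "L2_on d \<omega> (\<lambda>x. \<Sum>k\<in>K. f k x)"
  using assms(2,3)
proof (induction K rule: finite_induct)
  case empty
  then show ?case by (simp add: L2_on_def set_borel_measurable_def set_integrable_def)
next
  case (insert k K)
  then show ?case by (simp add: L2_on_add[OF \<omega>])
qed

text \<open>Nonnegativity is applied to the combinations \<open>t * v + w\<close>, so the domain of the form has to be linear.\<close>

lemma psd_Cauchy_Schwarz:
  assumes X: "linear_space X" and s: "psd_bilinear_form X s" and v: "v \<in> X" and w: "w \<in> X"
  shows "\<bar>s v w\<bar> \<le> sqrt (s v v) * sqrt (s w w)"
proof (rule abs_le_sqrt_mult_sqrt_of_quadratic_nonneg)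
  fix t :: real
  let ?u = "\<lambda>x. t * v x + w x"
  have "(\<lambda>x. t * v x) \<in> X" using X v unfolding linear_space_def by blast
  with X w have u: "?u \<in> X" unfolding linear_space_def by fast
  have lin: "s ?u z = t * s v z + s w z" if "z \<in> X" for z
    using s v w that unfolding psd_bilinear_form_def by blast
  have sym: "s y z = s z y" if "y \<in> X" "z \<in> X" for y z
    using s that unfolding psd_bilinear_form_def by blast
  have "0 \<le> s ?u ?u" using s u unfolding psd_bilinear_form_def by blast
  also have "\<dots> = t * s ?u v + s ?u w"
    using lin[OF u] sym[OF u v] sym[OF u w] by simp
  also have "\<dots> = t\<^sup>2 * s v v + 2 * t * s v w + s w w"
    using lin[OF v] lin[OF w] sym[OF v w] by (simp add: algebra_simps power2_eq_square)
  finally show "0 \<le> t\<^sup>2 * s v v + 2 * t * s v w + s w w" .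
next
  show "0 \<le> s v v" using s v unfolding psd_bilinear_form_def by blast
qed

section \<open>Interfaces and Dirichlet parts inside the boundaries of the pieces\<close>

lemma composite_surface_closed:
  assumes P: "composite_surface P" and i: "i \<in> surfs P"
  shows "closed (piece P i)" and "closed (bdry P i)" and "bdry P i \<subseteq> piece P i"
proof -
  have o: "oriented_surface_in (ambient P i) (piece P i) (nrml P i)"
    using P[unfolded composite_surface_def, THEN conjunct2, THEN conjunct2, THEN conjunct1] i
    by (rule bspec)
  then have S: "closed (ambient P i)"
    unfolding oriented_surface_in_def smooth_closed_surface_def by (auto intro: compact_imp_closed)
  have cl: "closedin (top_of_set (ambient P i)) (piece P i)"
    using o unfolding oriented_surface_in_def by (metis closedin_closure_of)
  show "closed (piece P i)" using cl S by (rule closedin_closed_trans)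
  have "closedin (top_of_set (ambient P i)) (bdry P i)"
    unfolding bdry_def by (rule closedin_frontier_of)
  then show "closed (bdry P i)" using S by (rule closedin_closed_trans)
  show "bdry P i \<subseteq> piece P i"
    unfolding bdry_def using cl by (rule frontier_of_subset_closedin)
qed

lemma composite_surface_borel:
  assumes P: "composite_surface P"
  shows "i \<in> surfs P \<Longrightarrow> piece P i \<in> sets borel"
    and "i \<in> surfs P \<Longrightarrow> bdry P i - neumann P \<in> sets borel"
    and "i \<in> surfs P \<Longrightarrow> dir_part P i \<in> sets borel"
    and "j \<in> ifaces P \<Longrightarrow> iface P j \<in> sets borel"
proof -
  have "dirichlet P \<in> sets borel"
    using P unfolding composite_surface_def by (elim conjE)
  moreover have "neumann P \<in> sets borel"
    using P unfolding composite_surface_def by (elim conjE)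
  moreover have "piece P i \<in> sets borel" "bdry P i \<in> sets borel" if "i \<in> surfs P"
    using composite_surface_closed(1,2)[OF P that] by (auto intro: borel_closed)
  ultimately show "i \<in> surfs P \<Longrightarrow> piece P i \<in> sets borel"
      "i \<in> surfs P \<Longrightarrow> bdry P i - neumann P \<in> sets borel"
      "i \<in> surfs P \<Longrightarrow> dir_part P i \<in> sets borel"
    unfolding dir_part_def by (auto intro: sets.Diff sets.Int)
  assume "j \<in> ifaces P"
  moreover have "\<forall>j\<in>ifaces P. smooth_curve (iface_param P j)"
    using P unfolding composite_surface_def by (elim conjE)
  ultimately have "path (iface_param P j)"
    unfolding smooth_curve_def by (blast dest: simple_path_imp_path)
  then show "iface P j \<in> sets borel"
    unfolding iface_def by (intro borel_closed closed_path_image)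
qed

lemma dir_part_subset:
  assumes "composite_surface P" shows "dir_part P i \<subseteq> bdry P i - neumann P"
proof -
  have "neumann P \<inter> dirichlet P = {}"
    using assms unfolding composite_surface_def by (elim conjE)
  then show ?thesis unfolding dir_part_def by blast
qed

text \<open>A point of an interface lies on two different pieces, at least one of which differs from any
  given piece, and different pieces meet in boundary points only.\<close>

lemma iface_subset:
  assumes P: "composite_surface P" and j: "j \<in> ifaces P" and k: "k \<in> sharing P j"
  shows "iface P j \<subseteq> bdry P k - neumann P"
proof
  fix x assume x: "x \<in> iface P j"
  have k': "k \<in> surfs P" "x \<in> piece P k" using k x unfolding sharing_def by auto
  have "(\<Union>j\<in>ifaces P. iface P j) =
        \<Union>{piece P i \<inter> piece P k | i k. i \<in> surfs P \<and> k \<in> surfs P \<and> i \<noteq> k \<and>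
              (\<nexists>x. piece P i \<inter> piece P k = {x})}"
    using P unfolding composite_surface_def by (elim conjE)
  with x j have "x \<in> \<Union>{piece P i \<inter> piece P k | i k. i \<in> surfs P \<and> k \<in> surfs P \<and> i \<noteq> k \<and>
              (\<nexists>x. piece P i \<inter> piece P k = {x})}"
    by blast
  then obtain l m where "l \<in> surfs P" "m \<in> surfs P" "l \<noteq> m" "x \<in> piece P l" "x \<in> piece P m"
    by blast
  then obtain q where q: "q \<in> surfs P" "k \<noteq> q" "x \<in> piece P q" by metis
  have "piece P i \<inter> piece P k = bdry P i \<inter> bdry P k"
    if "i \<in> surfs P" "k \<in> surfs P" "i \<noteq> k" "piece P i \<inter> piece P k \<noteq> {}" for i k
    using P[unfolded composite_surface_def, THEN conjunct2, THEN conjunct2, THEN conjunct2, THEN conjunct1]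
      that by blast
  from this[OF k'(1) q(1,2)] have b: "x \<in> bdry P k" using k' q by blast
  have "outer_boundary P = neumann P \<union> dirichlet P"
    using P unfolding composite_surface_def by (elim conjE)
  then have "x \<notin> neumann P" using x j unfolding outer_boundary_def by blast
  with b show "x \<in> bdry P k - neumann P" by blast
qed

section \<open>Estimates of the terms of the Nitsche form\<close>

text \<open>A composite surface together with explicit bounds for its coefficient. The lower
  bound \<open>c\<close> makes the penalty effective, the upper bound \<open>C\<close> enters the continuity constants.\<close>

locale bounded_composite =
  fixes P :: "('i, 'j) composite" and c C :: real
  assumes composite: "composite_surface P"
    and c_pos: "0 < c" and C_pos: "0 < C"
    and coeff_continuous: "i \<in> surfs P \<Longrightarrow> continuous_on (piece P i) (coeff P i)"
    and coeff_lower: "i \<in> surfs P \<Longrightarrow> x \<in> piece P i \<Longrightarrow> c \<le> coeff P i x"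
    and coeff_upper: "i \<in> surfs P \<Longrightarrow> x \<in> piece P i \<Longrightarrow> coeff P i x \<le> C"

lemma bounded_composite_exists:
  assumes "composite_surface P" "coefficient_bounds P"
  obtains c C where "bounded_composite P c C"
proof -
  obtain c C where "0 < c" "\<forall>i\<in>surfs P. \<forall>x\<in>piece P i. c \<le> coeff P i x \<and> coeff P i x \<le> C"
    using assms(2) unfolding coefficient_bounds_def by auto
  with assms have "bounded_composite P c (max C 1)"
    unfolding coefficient_bounds_def by unfold_locales (auto intro: max.coboundedI1)
  then show ?thesis by (rule that)
qed

lemma mult_le_of_squares_le:
  fixes x y X Y :: real
  assumes "x\<^sup>2 \<le> X\<^sup>2" "y\<^sup>2 \<le> Y\<^sup>2" "0 \<le> X" "0 \<le> Y"
  shows "x * y \<le> X * Y"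
proof -
  have "\<bar>x\<bar> \<le> X" "\<bar>y\<bar> \<le> Y" using assms abs_le_square_iff[of x X] abs_le_square_iff[of y Y] by auto
  then have "\<bar>x\<bar> * \<bar>y\<bar> \<le> X * Y" using assms by (intro mult_mono) auto
  then show ?thesis by (simp flip: abs_mult)
qed

lemma scaled_mult_le:
  fixes x y X Y h :: real
  assumes h: "0 < h" and "h * x\<^sup>2 \<le> X\<^sup>2" "inverse h * y\<^sup>2 \<le> Y\<^sup>2" "0 \<le> X" "0 \<le> Y"
  shows "x * y \<le> X * Y"
proof -
  have "(sqrt h * x) * (inverse (sqrt h) * y) \<le> X * Y"
    using assms by (intro mult_le_of_squares_le) (auto simp: power_mult_distrib power_inverse)
  moreover have "(sqrt h * x) * (inverse (sqrt h) * y) = x * y" using h by simp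
  ultimately show ?thesis by simp
qed

lemma inverse_scaled_mult_le:
  fixes x y X Y h :: real
  assumes h: "0 < h" and "inverse h * x\<^sup>2 \<le> X\<^sup>2" "inverse h * y\<^sup>2 \<le> Y\<^sup>2" "0 \<le> X" "0 \<le> Y"
  shows "inverse h * (x * y) \<le> X * Y"
proof -
  have "(inverse (sqrt h) * x) * (inverse (sqrt h) * y) \<le> X * Y"
    using assms by (intro mult_le_of_squares_le) (auto simp: power_mult_distrib power_inverse)
  moreover have "inverse h = inverse (sqrt h) * inverse (sqrt h)"
    using h by (simp flip: inverse_mult_distrib)
  ultimately show ?thesis by (simp add: mult_ac)
qed

lemma scaled_Young:
  fixes x y h \<delta> :: real
  assumes h: "0 < h" and \<delta>: "0 < \<delta>"
  shows "2 * (x * y) \<le> \<delta> * (h * x\<^sup>2) + (inverse h * y\<^sup>2) / \<delta>"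
proof -
  have "0 \<le> (\<delta> * h * x - y)\<^sup>2" by simp
  also have "\<dots> = \<delta> * h * (\<delta> * (h * x\<^sup>2) + (inverse h * y\<^sup>2) / \<delta> - 2 * (x * y))"
    using h \<delta> by (simp add: field_simps power2_eq_square)
  finally show ?thesis using mult_pos_pos[OF \<delta> h] by (simp add: zero_le_mult_iff)
qed

lemma energy_space_L2:
  assumes v: "v \<in> energy_space P i"
  shows energy_space_grad_L2: "L2_on 2 (piece P i) (grad P i v)"
    and energy_space_trace_L2: "\<omega> \<in> sets borel \<Longrightarrow> \<omega> \<subseteq> bdry P i - neumann P \<Longrightarrow> L2_on 1 \<omega> (piece_trace P i v)"
    and energy_space_deriv_L2: "\<omega> \<in> sets borel \<Longrightarrow> \<omega> \<subseteq> bdry P i - neumann P \<Longrightarrow> L2_on 1 \<omega> (conormal_deriv P i v)"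
proof -
  have "\<exists>g. has_tangential_gradient (ambient P i) (piece P i) (nrml P i) v g"
    using v unfolding energy_space_def H1_piece_def H1_def by blast
  then have "has_tangential_gradient (ambient P i) (piece P i) (nrml P i) v (grad P i v)"
    unfolding grad_def tangential_gradient_def by (rule someI_ex)
  then show "L2_on 2 (piece P i) (grad P i v)"
    unfolding has_tangential_gradient_def by blast
qed (use v in \<open>auto simp: energy_space_def intro: L2_on_subset\<close>)

context bounded_composite
begin

lemma finite_surfs [simp]: "finite (surfs P)"
  using composite unfolding composite_surface_def by (elim conjE)

lemma finite_ifaces [simp]: "finite (ifaces P)"
  using composite unfolding composite_surface_def by (elim conjE)

lemma finite_sharing [simp]: "finite (sharing P j)"
  unfolding sharing_def by simp

lemma sharing_surfs: "k \<in> sharing P j \<Longrightarrow> k \<in> surfs P"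
  unfolding sharing_def by simp

text \<open>The number of pairs of an interface and a piece that has it on its boundary.\<close>

definition iface_sides :: nat where
  "iface_sides = (\<Sum>j\<in>ifaces P. card (sharing P j))"

lemma sum_iface_sides_le:
  fixes K :: real
  assumes "\<And>j k. j \<in> ifaces P \<Longrightarrow> k \<in> sharing P j \<Longrightarrow> f j k \<le> K"
  shows "(\<Sum>j\<in>ifaces P. \<Sum>k\<in>sharing P j. f j k) \<le> iface_sides * K"
proof -
  have "(\<Sum>j\<in>ifaces P. \<Sum>k\<in>sharing P j. f j k) \<le> (\<Sum>j\<in>ifaces P. real (card (sharing P j)) * K)"
    by (intro sum_mono sum_bounded_above assms)
  then show ?thesis by (simp add: iface_sides_def sum_distrib_right)
qed

lemma coeff_measurable:
  assumes i: "i \<in> surfs P" and \<omega>: "\<omega> \<in> sets borel" "\<omega> \<subseteq> piece P i"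
  shows "set_borel_measurable (hausdorff_measure d) \<omega> (coeff P i)"
proof -
  have "(\<lambda>x. indicator \<omega> x *\<^sub>R coeff P i x) \<in> borel_measurable borel"
    using \<omega> continuous_on_subset[OF coeff_continuous[OF i]]
    by (intro borel_measurable_continuous_on_indicator) auto
  then show ?thesis
    unfolding set_borel_measurable_def by (simp cong: measurable_cong_sets)
qed

lemma energy_product:
  assumes i: "i \<in> surfs P" and v: "v \<in> energy_space P i" and w: "w \<in> energy_space P i"
  shows "\<bar>L2_inner 2 (piece P i) (\<lambda>x. coeff P i x *\<^sub>R grad P i v x) (grad P i w)\<bar>
    \<le> norm_a_piece P i v * norm_a_piece P i w"
  unfolding norm_a_piece_def
  by (intro weighted_Cauchy_Schwarz[where C = C] coeff_measurable i composite_surface_borel[OF composite]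
      energy_space_grad_L2 v w)
    (auto intro: coeff_upper[OF i] order_trans[OF _ coeff_lower[OF i]] less_imp_le[OF c_pos])

lemma norm_a_piece_squared:
  assumes i: "i \<in> surfs P"
  shows "(norm_a_piece P i v)\<^sup>2 = L2_inner 2 (piece P i) (\<lambda>x. coeff P i x *\<^sub>R grad P i v x) (grad P i v)"
proof -
  have "0 \<le> coeff P i x" if "x \<in> piece P i" for x
    using coeff_lower[OF i that] c_pos by simp
  then have "0 \<le> L2_inner 2 (piece P i) (\<lambda>x. coeff P i x *\<^sub>R grad P i v x) (grad P i v)"
    unfolding L2_inner_def set_lebesgue_integral_def
    by (intro integral_nonneg_AE AE_I2) (simp add: indicator_def)
  then show ?thesis unfolding norm_a_piece_def by simp
qed

lemma norm_a_squared:
  assumes h: "0 < h"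
  shows "(norm_a P h v)\<^sup>2 = (\<Sum>i\<in>surfs P. (norm_a_piece P i (v i))\<^sup>2)
   + (\<Sum>j\<in>ifaces P. \<Sum>k\<in>sharing P j.
        h * (L2_norm 1 (iface P j) (conormal_deriv P k (v k)))\<^sup>2
      + inverse h * (L2_norm 1 (iface P j) (deviation P j k v))\<^sup>2)
   + h * (\<Sum>i\<in>surfs P. (L2_norm 1 (dir_part P i) (conormal_deriv P i (v i)))\<^sup>2)
   + inverse h * (\<Sum>i\<in>surfs P. (L2_norm 1 (dir_part P i) (piece_trace P i (v i)))\<^sup>2)"
  unfolding norm_a_def using h
  by (subst real_sqrt_pow2) (auto intro!: add_nonneg_nonneg sum_nonneg mult_nonneg_nonneg)

lemma norm_a_nonneg: "0 < h \<Longrightarrow> 0 \<le> norm_a P h v"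
  unfolding norm_a_def by (auto intro!: add_nonneg_nonneg sum_nonneg mult_nonneg_nonneg)

lemma norm_a_bounds:
  assumes h: "0 < h"
  shows "i \<in> surfs P \<Longrightarrow> (norm_a_piece P i (v i))\<^sup>2 \<le> (norm_a P h v)\<^sup>2"
    and "j \<in> ifaces P \<Longrightarrow> k \<in> sharing P j \<Longrightarrow>
      h * (L2_norm 1 (iface P j) (conormal_deriv P k (v k)))\<^sup>2 \<le> (norm_a P h v)\<^sup>2"
    and "j \<in> ifaces P \<Longrightarrow> k \<in> sharing P j \<Longrightarrow>
      inverse h * (L2_norm 1 (iface P j) (deviation P j k v))\<^sup>2 \<le> (norm_a P h v)\<^sup>2"
    and "i \<in> surfs P \<Longrightarrow>
      h * (L2_norm 1 (dir_part P i) (conormal_deriv P i (v i)))\<^sup>2 \<le> (norm_a P h v)\<^sup>2"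
    and "i \<in> surfs P \<Longrightarrow>
      inverse h * (L2_norm 1 (dir_part P i) (piece_trace P i (v i)))\<^sup>2 \<le> (norm_a P h v)\<^sup>2"
proof -
  let ?A = "\<lambda>i. (norm_a_piece P i (v i))\<^sup>2"
  let ?B = "\<lambda>j k. h * (L2_norm 1 (iface P j) (conormal_deriv P k (v k)))\<^sup>2"
  let ?D = "\<lambda>j k. inverse h * (L2_norm 1 (iface P j) (deviation P j k v))\<^sup>2"
  let ?G = "\<lambda>i. h * (L2_norm 1 (dir_part P i) (conormal_deriv P i (v i)))\<^sup>2"
  let ?T = "\<lambda>i. inverse h * (L2_norm 1 (dir_part P i) (piece_trace P i (v i)))\<^sup>2"
  have nn: "0 \<le> ?B j k" "0 \<le> ?D j k" "0 \<le> ?G i" "0 \<le> ?T i" for i j k using h by auto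
  have eq: "(norm_a P h v)\<^sup>2 = sum ?A (surfs P) + (\<Sum>j\<in>ifaces P. \<Sum>k\<in>sharing P j. ?B j k + ?D j k)
      + sum ?G (surfs P) + sum ?T (surfs P)"
    unfolding norm_a_squared[OF h] by (simp add: sum_distrib_left)
  have S: "0 \<le> sum ?A (surfs P)" "0 \<le> (\<Sum>j\<in>ifaces P. \<Sum>k\<in>sharing P j. ?B j k + ?D j k)"
      "0 \<le> sum ?G (surfs P)" "0 \<le> sum ?T (surfs P)"
    by (intro sum_nonneg add_nonneg_nonneg nn zero_le_power2)+
  show "?A i \<le> (norm_a P h v)\<^sup>2" if "i \<in> surfs P"
    using member_le_sum[of i "surfs P" ?A] that S eq by simp
  show "?G i \<le> (norm_a P h v)\<^sup>2" if "i \<in> surfs P"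
    using member_le_sum[of i "surfs P" ?G] that S eq nn by simp
  show "?T i \<le> (norm_a P h v)\<^sup>2" if "i \<in> surfs P"
    using member_le_sum[of i "surfs P" ?T] that S eq nn by simp
  have "?B j k + ?D j k \<le> (norm_a P h v)\<^sup>2" if j: "j \<in> ifaces P" and k: "k \<in> sharing P j" for j k
  proof -
    have "?B j k + ?D j k \<le> (\<Sum>k\<in>sharing P j. ?B j k + ?D j k)"
      by (rule member_le_sum[OF k]) (intro add_nonneg_nonneg nn finite_sharing)+
    also have "\<dots> \<le> (\<Sum>j\<in>ifaces P. \<Sum>k\<in>sharing P j. ?B j k + ?D j k)"
      by (rule member_le_sum[OF j]) (intro sum_nonneg add_nonneg_nonneg nn finite_ifaces)+
    finally show ?thesis using S eq by linarith
  qed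
  with nn show "?B j k \<le> (norm_a P h v)\<^sup>2" "?D j k \<le> (norm_a P h v)\<^sup>2"
    if "j \<in> ifaces P" "k \<in> sharing P j"
    using that by (meson add_increasing add_increasing2 order_refl order_trans)+
qed

lemma deviation_L2:
  assumes j: "j \<in> ifaces P" and k: "k \<in> sharing P j" and v: "v \<in> broken_space P (energy_space P)"
  shows "L2_on 1 (iface P j) (deviation P j k v)"
proof -
  note b = composite_surface_borel(4)[OF composite j]
  have t: "L2_on 1 (iface P j) (piece_trace P l (v l))" if l: "l \<in> sharing P j" for l
    using v sharing_surfs[OF l] unfolding broken_space_def
    by (intro energy_space_trace_L2 b iface_subset composite j l) auto
  have "L2_on 1 (iface P j) (\<lambda>x. piece_trace P k (v k) x
      + (- 1) * (\<Sum>l\<in>sharing P j. weight P j l * piece_trace P l (v l) x))"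
    by (intro L2_on_add L2_on_const_mult L2_on_sum b t k) auto
  also have "(\<lambda>x. piece_trace P k (v k) x
      + (- 1) * (\<Sum>l\<in>sharing P j. weight P j l * piece_trace P l (v l) x)) = deviation P j k v"
    by (auto simp: deviation_def average_def)
  finally show ?thesis .
qed

end

text \<open>A measurable part of the boundary of one piece that does not meet the Neumann boundary: on it the
  traces and the conormal derivatives of energy functions are square integrable. Interfaces, seen from
  one of their sides, and Dirichlet parts are of this kind.\<close>

locale boundary_portion = bounded_composite P c C
  for P :: "('i, 'j) composite" and c C +
  fixes i :: 'i and \<omega> :: "(real^3) set"
  assumes i: "i \<in> surfs P" and \<omega>: "\<omega> \<in> sets borel" "\<omega> \<subseteq> bdry P i - neumann P"
begin

lemma coeff_on_portion:
  shows "set_borel_measurable (hausdorff_measure d) \<omega> (coeff P i)"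
    and "x \<in> \<omega> \<Longrightarrow> c \<le> coeff P i x" and "x \<in> \<omega> \<Longrightarrow> coeff P i x \<le> C" and "x \<in> \<omega> \<Longrightarrow> 0 \<le> coeff P i x"
proof -
  have s: "\<omega> \<subseteq> piece P i" using \<omega> composite_surface_closed(3)[OF composite i] by auto
  show "set_borel_measurable (hausdorff_measure d) \<omega> (coeff P i)"
    by (rule coeff_measurable[OF i \<omega>(1) s])
  show "x \<in> \<omega> \<Longrightarrow> c \<le> coeff P i x" "x \<in> \<omega> \<Longrightarrow> coeff P i x \<le> C"
    using coeff_lower[OF i] coeff_upper[OF i] s by auto
  then show "x \<in> \<omega> \<Longrightarrow> 0 \<le> coeff P i x" using c_pos by fastforce
qed

lemma flux_L2:
  assumes "v \<in> energy_space P i"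
  shows "L2_on 1 \<omega> (conormal_flux P i v)"
proof -
  have "L2_on 1 \<omega> (\<lambda>x. coeff P i x * conormal_deriv P i v x)"
    using coeff_on_portion energy_space_deriv_L2[OF assms \<omega>]
    by (intro L2_on_bounded_mult[where C = C]) auto
  also have "(\<lambda>x. coeff P i x * conormal_deriv P i v x) = conormal_flux P i v"
    by (simp add: conormal_flux_def fun_eq_iff)
  finally show ?thesis .
qed

lemma flux_bound:
  assumes v: "v \<in> energy_space P i" and g: "L2_on 1 \<omega> g"
  shows "\<bar>L2_inner 1 \<omega> (conormal_flux P i v) g\<bar> \<le> C * (L2_norm 1 \<omega> (conormal_deriv P i v) * L2_norm 1 \<omega> g)"
proof -
  have "(\<lambda>x. coeff P i x *\<^sub>R conormal_deriv P i v x) = conormal_flux P i v"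
    by (simp add: conormal_flux_def fun_eq_iff)
  with weighted_Cauchy_Schwarz_bounded[OF \<omega>(1) coeff_on_portion(1,4,3) less_imp_le[OF C_pos]
      energy_space_deriv_L2[OF v \<omega>] g]
  show ?thesis by simp
qed

lemma deriv_le_flux:
  assumes v: "v \<in> energy_space P i"
  shows "c\<^sup>2 * (L2_norm 1 \<omega> (conormal_deriv P i v))\<^sup>2 \<le> (L2_norm 1 \<omega> (conormal_flux P i v))\<^sup>2"
proof -
  note d = energy_space_deriv_L2[OF v \<omega>]
  have "set_integrable (hausdorff_measure 1) \<omega> (\<lambda>x. c\<^sup>2 * (conormal_deriv P i v x \<bullet> conormal_deriv P i v x))"
    by (intro set_integrable_mult_right inner_integrable d \<omega>)
  moreover have "set_integrable (hausdorff_measure 1) \<omega> (\<lambda>x. conormal_flux P i v x \<bullet> conormal_flux P i v x)"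
    by (intro inner_integrable flux_L2 v \<omega>)
  moreover have "c\<^sup>2 * (conormal_deriv P i v x \<bullet> conormal_deriv P i v x)
      \<le> conormal_flux P i v x \<bullet> conormal_flux P i v x" if "x \<in> \<omega>" for x
    using mult_right_mono[OF power_mono[OF coeff_on_portion(2)[OF that], of 2],
        of "(conormal_deriv P i v x)\<^sup>2"] c_pos
    by (simp add: conormal_flux_def power2_eq_square mult_ac)
  ultimately have "(LINT x:\<omega>|hausdorff_measure 1. c\<^sup>2 * (conormal_deriv P i v x \<bullet> conormal_deriv P i v x))
      \<le> (LINT x:\<omega>|hausdorff_measure 1. conormal_flux P i v x \<bullet> conormal_flux P i v x)"
    by (rule set_integral_mono)
  then show ?thesis unfolding L2_norm_squared L2_inner_def by simp
qed

lemma penalty_eq: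
  "L2_inner 1 \<omega> (\<lambda>x. \<beta> * coeff P i x * inverse h * f x) g
    = \<beta> * (inverse h * L2_inner 1 \<omega> (\<lambda>x. coeff P i x *\<^sub>R f x) g)"
proof -
  have "L2_inner 1 \<omega> (\<lambda>x. \<beta> * coeff P i x * inverse h * f x) g
      = (LINT x:\<omega>|hausdorff_measure 1. (\<beta> * inverse h) * ((coeff P i x *\<^sub>R f x) \<bullet> g x))"
    unfolding L2_inner_def by (simp add: mult_ac)
  also have "\<dots> = \<beta> * (inverse h * L2_inner 1 \<omega> (\<lambda>x. coeff P i x *\<^sub>R f x) g)"
    unfolding L2_inner_def by (simp only: set_integral_mult_right mult.assoc)
  finally show ?thesis .
qed

lemma penalty_bound:
  assumes "L2_on 1 \<omega> f" "L2_on 1 \<omega> g" and h: "0 < h" "0 < \<beta>"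
  shows "L2_inner 1 \<omega> (\<lambda>x. \<beta> * coeff P i x * inverse h * f x) g
    \<le> \<beta> * C * (inverse h * (L2_norm 1 \<omega> f * L2_norm 1 \<omega> g))"
proof -
  have "L2_inner 1 \<omega> (\<lambda>x. coeff P i x *\<^sub>R f x) g \<le> C * (L2_norm 1 \<omega> f * L2_norm 1 \<omega> g)"
    using weighted_Cauchy_Schwarz_bounded[OF \<omega>(1) coeff_on_portion(1,4,3) less_imp_le[OF C_pos] assms(1,2)]
    by (meson abs_le_D1)
  then have "\<beta> * (inverse h * L2_inner 1 \<omega> (\<lambda>x. coeff P i x *\<^sub>R f x) g)
      \<le> \<beta> * (inverse h * (C * (L2_norm 1 \<omega> f * L2_norm 1 \<omega> g)))"
    using h by (intro mult_left_mono) auto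
  then show ?thesis unfolding penalty_eq by (simp only: mult_ac)
qed

lemma penalty_lower:
  assumes "L2_on 1 \<omega> g" and h: "0 < h" "0 < \<beta>"
  shows "\<beta> * c * (inverse h * (L2_norm 1 \<omega> g)\<^sup>2)
    \<le> L2_inner 1 \<omega> (\<lambda>x. \<beta> * coeff P i x * inverse h * g x) g"
proof -
  have "c * (L2_norm 1 \<omega> g)\<^sup>2 \<le> L2_inner 1 \<omega> (\<lambda>x. coeff P i x *\<^sub>R g x) g"
    by (rule weighted_inner_self_bounds(1)[OF \<omega>(1) coeff_on_portion(1-3) less_imp_le[OF c_pos] assms(1)])
  then have "\<beta> * (inverse h * (c * (L2_norm 1 \<omega> g)\<^sup>2))
      \<le> \<beta> * (inverse h * L2_inner 1 \<omega> (\<lambda>x. coeff P i x *\<^sub>R g x) g)"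
    using h by (intro mult_left_mono) auto
  then show ?thesis unfolding penalty_eq by (simp only: mult_ac)
qed

lemma flux_Young:
  assumes v: "v \<in> energy_space P i" and g: "L2_on 1 \<omega> g" and h: "0 < h" "0 < \<delta>"
  shows "2 * L2_inner 1 \<omega> (conormal_flux P i v) g
    \<le> \<delta> * (h * (L2_norm 1 \<omega> (conormal_flux P i v))\<^sup>2) + (inverse h * (L2_norm 1 \<omega> g)\<^sup>2) / \<delta>"
  using L2_Cauchy_Schwarz[OF \<omega>(1) flux_L2[OF v] g]
    scaled_Young[OF h, of "L2_norm 1 \<omega> (conormal_flux P i v)" "L2_norm 1 \<omega> g"] by simp

lemma flux_norm_mono:
  assumes v: "v \<in> energy_space P i"
  shows "(L2_norm 1 \<omega> (conormal_flux P i v))\<^sup>2 \<le> (L2_norm 1 (bdry P i - neumann P) (conormal_flux P i v))\<^sup>2"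
proof -
  have b: "bdry P i - neumann P \<in> sets borel" by (rule composite_surface_borel(2)[OF composite i])
  interpret B: boundary_portion P c C i "bdry P i - neumann P"
    by unfold_locales (auto intro: i b)
  show ?thesis by (rule L2_norm_squared_mono_set[OF B.flux_L2[OF v] \<omega> b])
qed

end

context bounded_composite
begin

lemma iface_portion:
  "j \<in> ifaces P \<Longrightarrow> k \<in> sharing P j \<Longrightarrow> boundary_portion P c C k (iface P j)"
  using composite_surface_borel(4)[OF composite] iface_subset[OF composite] sharing_surfs
  by unfold_locales auto

lemma dir_portion: "i \<in> surfs P \<Longrightarrow> boundary_portion P c C i (dir_part P i)"
  using composite_surface_borel(3)[OF composite] dir_part_subset[OF composite]
  by unfold_locales auto

lemma dir_trace_L2:
  assumes i: "i \<in> surfs P" and v: "v \<in> energy_space P i"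
  shows "L2_on 1 (dir_part P i) (piece_trace P i v)"
  by (intro energy_space_trace_L2 v composite_surface_borel(3)[OF composite i] dir_part_subset composite)

end

section \<open>Continuity and coercivity\<close>

context bounded_composite
begin

lemma a_form_continuous:
  assumes h: "0 < h" and \<beta>: "0 < \<beta>"
    and v: "v \<in> broken_space P (energy_space P)" and w: "w \<in> broken_space P (energy_space P)"
  shows "a_form P \<beta> h v w
    \<le> (real (card (surfs P)) + real (iface_sides + card (surfs P)) * (2 * C + \<beta> * C)) * (norm_a P h v * norm_a P h w)"
proof -
  let ?N = "norm_a P h v * norm_a P h w"
  have ve: "v i \<in> energy_space P i" and we: "w i \<in> energy_space P i" if "i \<in> surfs P" for i
    using v w that unfolding broken_space_def by auto
  note nn = norm_a_nonneg[OF h]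
  have \<beta>C: "0 \<le> \<beta> * C" using \<beta> C_pos by simp
  have bulk: "L2_inner 2 (piece P i) (\<lambda>x. coeff P i x *\<^sub>R grad P i (v i) x) (grad P i (w i)) \<le> ?N"
    if i: "i \<in> surfs P" for i
    using energy_product[OF i ve[OF i] we[OF i]]
      mult_le_of_squares_le[OF norm_a_bounds(1)[OF h i] norm_a_bounds(1)[OF h i] nn nn]
    by (meson abs_le_D1 order_trans)
  have iface_flux: "\<bar>L2_inner 1 (iface P j) (conormal_flux P k (v k)) (deviation P j k w)
      + L2_inner 1 (iface P j) (deviation P j k v) (conormal_flux P k (w k))\<bar> \<le> 2 * C * ?N"
    and iface_penalty: "L2_inner 1 (iface P j)
      (\<lambda>x. \<beta> * coeff P k x * inverse h * deviation P j k v x) (deviation P j k w) \<le> \<beta> * C * ?N"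
    if j: "j \<in> ifaces P" and k: "k \<in> sharing P j" for j k
  proof -
    note k' = sharing_surfs[OF k]
    interpret B: boundary_portion P c C k "iface P j" by (rule iface_portion[OF j k])
    note dv = deviation_L2[OF j k v] and dw = deviation_L2[OF j k w]
    have 1: "L2_norm 1 (iface P j) (conormal_deriv P k (v k)) * L2_norm 1 (iface P j) (deviation P j k w) \<le> ?N"
      using norm_a_bounds(2,3)[OF h j k] by (intro scaled_mult_le[OF h] nn)
    have 2: "L2_norm 1 (iface P j) (conormal_deriv P k (w k)) * L2_norm 1 (iface P j) (deviation P j k v)
        \<le> norm_a P h w * norm_a P h v"
      using norm_a_bounds(2,3)[OF h j k] by (intro scaled_mult_le[OF h] nn)
    have "\<bar>L2_inner 1 (iface P j) (conormal_flux P k (v k)) (deviation P j k w)\<bar> \<le> C * ?N"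
      using B.flux_bound[OF ve[OF k'] dw] mult_left_mono[OF 1 less_imp_le[OF C_pos]] by (rule order_trans)
    moreover have "\<bar>L2_inner 1 (iface P j) (deviation P j k v) (conormal_flux P k (w k))\<bar>
        \<le> C * (norm_a P h w * norm_a P h v)"
      using B.flux_bound[OF we[OF k'] dv] mult_left_mono[OF 2 less_imp_le[OF C_pos]]
      unfolding L2_inner_commute[of _ _ "deviation P j k v"] by (rule order_trans)
    ultimately show "\<bar>L2_inner 1 (iface P j) (conormal_flux P k (v k)) (deviation P j k w)
      + L2_inner 1 (iface P j) (deviation P j k v) (conormal_flux P k (w k))\<bar> \<le> 2 * C * ?N"
      by (simp only: mult.commute[of "norm_a P h w"])
    have 3: "inverse h * (L2_norm 1 (iface P j) (deviation P j k v) * L2_norm 1 (iface P j) (deviation P j k w)) \<le> ?N"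
      using norm_a_bounds(3)[OF h j k] by (intro inverse_scaled_mult_le[OF h] nn)
    show "L2_inner 1 (iface P j)
      (\<lambda>x. \<beta> * coeff P k x * inverse h * deviation P j k v x) (deviation P j k w) \<le> \<beta> * C * ?N"
      using B.penalty_bound[OF dv dw h \<beta>] mult_left_mono[OF 3 \<beta>C] by (rule order_trans)
  qed
  have dir_flux: "\<bar>L2_inner 1 (dir_part P i) (conormal_flux P i (v i)) (piece_trace P i (w i))\<bar> \<le> C * ?N"
      "\<bar>L2_inner 1 (dir_part P i) (piece_trace P i (v i)) (conormal_flux P i (w i))\<bar> \<le> C * ?N"
    and dir_penalty: "L2_inner 1 (dir_part P i)
      (\<lambda>x. \<beta> * coeff P i x * inverse h * piece_trace P i (v i) x) (piece_trace P i (w i)) \<le> \<beta> * C * ?N"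
    if i: "i \<in> surfs P" for i
  proof -
    interpret B: boundary_portion P c C i "dir_part P i" by (rule dir_portion[OF i])
    note tv = dir_trace_L2[OF i ve[OF i]] and tw = dir_trace_L2[OF i we[OF i]]
    have 1: "L2_norm 1 (dir_part P i) (conormal_deriv P i (v i)) * L2_norm 1 (dir_part P i) (piece_trace P i (w i)) \<le> ?N"
      using norm_a_bounds(4,5)[OF h i] by (intro scaled_mult_le[OF h] nn)
    have 2: "L2_norm 1 (dir_part P i) (conormal_deriv P i (w i)) * L2_norm 1 (dir_part P i) (piece_trace P i (v i))
        \<le> norm_a P h w * norm_a P h v"
      using norm_a_bounds(4,5)[OF h i] by (intro scaled_mult_le[OF h] nn)
    show "\<bar>L2_inner 1 (dir_part P i) (conormal_flux P i (v i)) (piece_trace P i (w i))\<bar> \<le> C * ?N"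
      using B.flux_bound[OF ve[OF i] tw] mult_left_mono[OF 1 less_imp_le[OF C_pos]] by (rule order_trans)
    have "\<bar>L2_inner 1 (dir_part P i) (piece_trace P i (v i)) (conormal_flux P i (w i))\<bar>
        \<le> C * (norm_a P h w * norm_a P h v)"
      using B.flux_bound[OF we[OF i] tv] mult_left_mono[OF 2 less_imp_le[OF C_pos]]
      unfolding L2_inner_commute[of _ _ "piece_trace P i (v i)"] by (rule order_trans)
    then show "\<bar>L2_inner 1 (dir_part P i) (piece_trace P i (v i)) (conormal_flux P i (w i))\<bar> \<le> C * ?N"
      by (simp only: mult.commute)
    have 3: "inverse h * (L2_norm 1 (dir_part P i) (piece_trace P i (v i)) * L2_norm 1 (dir_part P i) (piece_trace P i (w i))) \<le> ?N"
      using norm_a_bounds(5)[OF h i] by (intro inverse_scaled_mult_le[OF h] nn)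
    show "L2_inner 1 (dir_part P i)
      (\<lambda>x. \<beta> * coeff P i x * inverse h * piece_trace P i (v i) x) (piece_trace P i (w i)) \<le> \<beta> * C * ?N"
      using B.penalty_bound[OF tv tw h \<beta>] mult_left_mono[OF 3 \<beta>C] by (rule order_trans)
  qed
  have s1: "(\<Sum>i\<in>surfs P. L2_inner 2 (piece P i) (\<lambda>x. coeff P i x *\<^sub>R grad P i (v i) x) (grad P i (w i)))
      \<le> card (surfs P) * ?N"
    by (rule sum_bounded_above[OF bulk])
  have s2: "(\<Sum>j\<in>ifaces P. \<Sum>k\<in>sharing P j.
        - (L2_inner 1 (iface P j) (conormal_flux P k (v k)) (deviation P j k w)
          + L2_inner 1 (iface P j) (deviation P j k v) (conormal_flux P k (w k)))) \<le> iface_sides * (2 * C * ?N)"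
    by (intro sum_iface_sides_le abs_le_D2 iface_flux)
  have s3: "(\<Sum>j\<in>ifaces P. \<Sum>k\<in>sharing P j.
        L2_inner 1 (iface P j) (\<lambda>x. \<beta> * coeff P k x * inverse h * deviation P j k v x) (deviation P j k w))
      \<le> iface_sides * (\<beta> * C * ?N)"
    by (intro sum_iface_sides_le iface_penalty)
  have s4: "(\<Sum>i\<in>surfs P. - L2_inner 1 (dir_part P i) (conormal_flux P i (v i)) (piece_trace P i (w i)))
      \<le> card (surfs P) * (C * ?N)"
    by (intro sum_bounded_above abs_le_D2 dir_flux)
  have s5: "(\<Sum>i\<in>surfs P. - L2_inner 1 (dir_part P i) (piece_trace P i (v i)) (conormal_flux P i (w i)))
      \<le> card (surfs P) * (C * ?N)"
    by (intro sum_bounded_above abs_le_D2 dir_flux)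
  have s6: "(\<Sum>i\<in>surfs P. L2_inner 1 (dir_part P i)
      (\<lambda>x. \<beta> * coeff P i x * inverse h * piece_trace P i (v i) x) (piece_trace P i (w i)))
      \<le> card (surfs P) * (\<beta> * C * ?N)"
    by (intro sum_bounded_above dir_penalty)
  have "a_form P \<beta> h v w \<le> card (surfs P) * ?N + iface_sides * (2 * C * ?N) + iface_sides * (\<beta> * C * ?N)
      + card (surfs P) * (C * ?N) + card (surfs P) * (C * ?N) + card (surfs P) * (\<beta> * C * ?N)"
    using s1 s2 s3 s4 s5 s6 unfolding a_form_def sum_negf by linarith
  also have "\<dots> = (real (card (surfs P)) + real (iface_sides + card (surfs P)) * (2 * C + \<beta> * C)) * ?N"
    by (simp add: algebra_simps)
  finally show ?thesis .
qed

lemma s_form_nonneg: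
  assumes "\<And>i. i \<in> surfs P \<Longrightarrow> psd_bilinear_form (X i) (s i)" "v \<in> broken_space P X"
  shows "0 \<le> s_form P s v v"
  using assms unfolding s_form_def broken_space_def psd_bilinear_form_def
  by (intro sum_nonneg) blast

lemma s_form_continuous:
  assumes X: "\<And>i. i \<in> surfs P \<Longrightarrow> linear_space (X i)"
    and s: "\<And>i. i \<in> surfs P \<Longrightarrow> psd_bilinear_form (X i) (s i)"
    and v: "v \<in> broken_space P X" and w: "w \<in> broken_space P X"
  shows "s_form P s v w \<le> card (surfs P) * (norm_s P s v * norm_s P s w)"
proof -
  have piece: "sqrt (s i (u i) (u i)) \<le> norm_s P s u"
    if "i \<in> surfs P" and u: "u \<in> broken_space P X" for i u
  proof -
    have "0 \<le> s k (u k) (u k)" if "k \<in> surfs P" for k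
      using s[OF that] u that unfolding broken_space_def psd_bilinear_form_def by blast
    then show ?thesis
      unfolding norm_s_def s_form_def using \<open>i \<in> surfs P\<close>
      by (intro real_sqrt_le_mono member_le_sum[of i _ "\<lambda>i. s i (u i) (u i)"]) auto
  qed
  have "s i (v i) (w i) \<le> norm_s P s v * norm_s P s w" if i: "i \<in> surfs P" for i
  proof -
    have vw: "v i \<in> X i" "w i \<in> X i" using v w i unfolding broken_space_def by auto
    have n: "0 \<le> s i (v i) (v i)" "0 \<le> s i (w i) (w i)"
      using s[OF i] vw unfolding psd_bilinear_form_def by blast+
    have "s i (v i) (w i) \<le> sqrt (s i (v i) (v i)) * sqrt (s i (w i) (w i))"
      using psd_Cauchy_Schwarz[OF X[OF i] s[OF i] vw] by simp
    also have "\<dots> \<le> norm_s P s v * norm_s P s w"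
      using n order_trans[OF _ piece[OF i v]]
      by (intro mult_mono piece i v w) auto
    finally show ?thesis .
  qed
  then show ?thesis unfolding s_form_def by (rule sum_bounded_above)
qed

lemma norm_parts_le_norm_A:
  "norm_a P h v \<le> norm_A P h s v" "norm_s P s v \<le> norm_A P h s v"
  unfolding norm_A_def by (auto intro: real_le_rsqrt)

lemma A_form_continuous:
  assumes h: "0 < h" and \<beta>: "0 < \<beta>"
    and X: "\<And>i. i \<in> surfs P \<Longrightarrow> linear_space (X i)"
    and s: "\<And>i. i \<in> surfs P \<Longrightarrow> psd_bilinear_form (X i) (s i)"
    and v: "v \<in> broken_space P (energy_space P) \<inter> broken_space P X"
    and w: "w \<in> broken_space P (energy_space P) \<inter> broken_space P X"
  shows "A_form P \<beta> h s v w
    \<le> (2 * card (surfs P) + real (iface_sides + card (surfs P)) * (2 * C + \<beta> * C)) * (norm_A P h s v * norm_A P h s w)"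
proof -
  let ?K = "real (card (surfs P)) + real (iface_sides + card (surfs P)) * (2 * C + \<beta> * C)"
  let ?NA = "norm_A P h s v * norm_A P h s w"
  have K: "0 \<le> ?K" using C_pos \<beta> by simp
  have NA: "0 \<le> norm_A P h s u" for u unfolding norm_A_def by simp
  have sn: "0 \<le> norm_s P s u" if "u \<in> broken_space P X" for u
    unfolding norm_s_def using s_form_nonneg[OF s that] by simp
  have "a_form P \<beta> h v w \<le> ?K * (norm_a P h v * norm_a P h w)"
    using v w by (intro a_form_continuous[OF h \<beta>]) auto
  also have "\<dots> \<le> ?K * ?NA"
    using K by (intro mult_left_mono mult_mono norm_parts_le_norm_A NA norm_a_nonneg h)
  finally have a: "a_form P \<beta> h v w \<le> ?K * ?NA" .
  have "s_form P s v w \<le> card (surfs P) * (norm_s P s v * norm_s P s w)"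
    using v w by (intro s_form_continuous[OF X s]) auto
  also have "\<dots> \<le> card (surfs P) * ?NA"
    using v w by (intro mult_left_mono mult_mono norm_parts_le_norm_A NA sn) auto
  finally have "A_form P \<beta> h s v w \<le> ?K * ?NA + card (surfs P) * ?NA"
    using a unfolding A_form_def by linarith
  then show ?thesis by (simp add: algebra_simps)
qed

text \<open>Young's inequality with parameter \<open>1 / (2 * K)\<close> makes the flux terms cost at most half of the
  energy; the price \<open>2 * K\<close> in front of the jump terms is paid by the penalty.\<close>

lemma A_form_coercive:
  assumes h: "0 < h" and \<beta>: "0 < \<beta>" and \<beta>_large: "2 * K + 1 \<le> \<beta> * c"
    and K0: "0 \<le> K\<^sub>0" and K: "real (iface_sides + card (surfs P)) * K\<^sub>0 \<le> K" "0 < K"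
    and v: "v \<in> broken_space P (energy_space P)"
    and s: "\<And>i. i \<in> surfs P \<Longrightarrow> 0 \<le> s i (v i) (v i)"
    and inverse: "\<And>i. i \<in> surfs P \<Longrightarrow> h * (L2_norm 1 (bdry P i - neumann P) (conormal_flux P i (v i)))\<^sup>2
      \<le> K\<^sub>0 * ((norm_a_piece P i (v i))\<^sup>2 + s i (v i) (v i))"
  shows "(norm_A P h s v)\<^sup>2 \<le> 2 * (1 + K / c\<^sup>2) * A_form P \<beta> h s v v"
proof -
  have ve: "v i \<in> energy_space P i" if "i \<in> surfs P" for i
    using v that unfolding broken_space_def by auto
  define \<delta> where "\<delta> = 1 / (2 * K)"
  have \<delta>: "0 < \<delta>" unfolding \<delta>_def using K by simp
  define E where "E i = (norm_a_piece P i (v i))\<^sup>2 + s i (v i) (v i)" for i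
  define E' where "E' = sum E (surfs P)"
  define F where "F j k = h * (L2_norm 1 (iface P j) (conormal_flux P k (v k)))\<^sup>2" for j k
  define G where "G i = h * (L2_norm 1 (dir_part P i) (conormal_flux P i (v i)))\<^sup>2" for i
  define T where "T j k = inverse h * (L2_norm 1 (iface P j) (deviation P j k v))\<^sup>2" for j k
  define U where "U i = inverse h * (L2_norm 1 (dir_part P i) (piece_trace P i (v i)))\<^sup>2" for i
  define F' where "F' = (\<Sum>j\<in>ifaces P. \<Sum>k\<in>sharing P j. F j k) + sum G (surfs P)"
  define T' where "T' = (\<Sum>j\<in>ifaces P. \<Sum>k\<in>sharing P j. T j k) + sum U (surfs P)"
  have E_nonneg: "0 \<le> E i" if "i \<in> surfs P" for i unfolding E_def using s[OF that] by simp
  have E'_nonneg: "0 \<le> E'" unfolding E'_def by (intro sum_nonneg E_nonneg)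
  have E_le: "E i \<le> E'" if "i \<in> surfs P" for i
    unfolding E'_def using that E_nonneg by (intro member_le_sum) auto
  have T'_nonneg: "0 \<le> T'"
    unfolding T'_def T_def U_def using h by (intro add_nonneg_nonneg sum_nonneg) auto

  have flux_le: "h * (L2_norm 1 \<omega> (conormal_flux P i (v i)))\<^sup>2 \<le> K\<^sub>0 * E'"
    if i: "i \<in> surfs P" and \<omega>: "boundary_portion P c C i \<omega>" for i \<omega>
  proof -
    have "h * (L2_norm 1 \<omega> (conormal_flux P i (v i)))\<^sup>2
        \<le> h * (L2_norm 1 (bdry P i - neumann P) (conormal_flux P i (v i)))\<^sup>2"
      using h by (intro mult_left_mono boundary_portion.flux_norm_mono[OF \<omega>] ve i) auto
    also have "\<dots> \<le> K\<^sub>0 * E i" unfolding E_def by (rule inverse[OF i])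
    also have "\<dots> \<le> K\<^sub>0 * E'" by (intro mult_left_mono E_le i K0)
    finally show ?thesis .
  qed
  have "(\<Sum>j\<in>ifaces P. \<Sum>k\<in>sharing P j. F j k) \<le> iface_sides * (K\<^sub>0 * E')"
    unfolding F_def by (intro sum_iface_sides_le flux_le iface_portion) (auto dest: sharing_surfs)
  moreover have "sum G (surfs P) \<le> card (surfs P) * (K\<^sub>0 * E')"
    unfolding G_def by (intro sum_bounded_above flux_le dir_portion)
  ultimately have "F' \<le> (real (iface_sides + card (surfs P)) * K\<^sub>0) * E'"
    unfolding F'_def by (simp add: algebra_simps)
  also have "\<dots> \<le> K * E'" by (intro mult_right_mono K E'_nonneg)
  finally have F'_le: "F' \<le> K * E'" .

  have iface_term: "\<beta> * c * T j k - (\<delta> * F j k + T j k / \<delta>)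
      \<le> L2_inner 1 (iface P j) (\<lambda>x. \<beta> * coeff P k x * inverse h * deviation P j k v x) (deviation P j k v)
        - (L2_inner 1 (iface P j) (conormal_flux P k (v k)) (deviation P j k v)
          + L2_inner 1 (iface P j) (deviation P j k v) (conormal_flux P k (v k)))"
    if j: "j \<in> ifaces P" and k: "k \<in> sharing P j" for j k
  proof -
    interpret B: boundary_portion P c C k "iface P j" by (rule iface_portion[OF j k])
    note d = deviation_L2[OF j k v]
    show ?thesis
      using B.penalty_lower[OF d h \<beta>] B.flux_Young[OF ve[OF sharing_surfs[OF k]] d h \<delta>]
      unfolding F_def T_def L2_inner_commute[of _ _ "deviation P j k v" "conormal_flux P k (v k)"]
      by linarith
  qed
  have dir_term: "\<beta> * c * U i - (\<delta> * G i + U i / \<delta>)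
      \<le> L2_inner 1 (dir_part P i) (\<lambda>x. \<beta> * coeff P i x * inverse h * piece_trace P i (v i) x) (piece_trace P i (v i))
        - L2_inner 1 (dir_part P i) (conormal_flux P i (v i)) (piece_trace P i (v i))
        - L2_inner 1 (dir_part P i) (piece_trace P i (v i)) (conormal_flux P i (v i))"
    if i: "i \<in> surfs P" for i
  proof -
    interpret B: boundary_portion P c C i "dir_part P i" by (rule dir_portion[OF i])
    note d = dir_trace_L2[OF i ve[OF i]]
    show ?thesis
      using B.penalty_lower[OF d h \<beta>] B.flux_Young[OF ve[OF i] d h \<delta>]
      unfolding G_def U_def L2_inner_commute[of _ _ "piece_trace P i (v i)" "conormal_flux P i (v i)"]
      by linarith
  qed
  have "(\<Sum>i\<in>surfs P. (norm_a_piece P i (v i))\<^sup>2)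
      = (\<Sum>i\<in>surfs P. L2_inner 2 (piece P i) (\<lambda>x. coeff P i x *\<^sub>R grad P i (v i) x) (grad P i (v i)))"
    by (intro sum.cong refl norm_a_piece_squared)
  moreover have E'_eq: "E' = (\<Sum>i\<in>surfs P. (norm_a_piece P i (v i))\<^sup>2) + s_form P s v v"
    unfolding E'_def E_def s_form_def by (rule sum.distrib)
  moreover have "(\<Sum>j\<in>ifaces P. \<Sum>k\<in>sharing P j. \<beta> * c * T j k - (\<delta> * F j k + T j k / \<delta>))
      + (\<Sum>i\<in>surfs P. \<beta> * c * U i - (\<delta> * G i + U i / \<delta>)) = \<beta> * c * T' - (\<delta> * F' + T' / \<delta>)"
    unfolding T'_def F'_def
    by (simp add: sum_subtractf sum.distrib sum_distrib_left sum_divide_distrib algebra_simps add_divide_distrib)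
  moreover have "(\<Sum>j\<in>ifaces P. \<Sum>k\<in>sharing P j. \<beta> * c * T j k - (\<delta> * F j k + T j k / \<delta>))
      \<le> (\<Sum>j\<in>ifaces P. \<Sum>k\<in>sharing P j.
        L2_inner 1 (iface P j) (\<lambda>x. \<beta> * coeff P k x * inverse h * deviation P j k v x) (deviation P j k v)
        - (L2_inner 1 (iface P j) (conormal_flux P k (v k)) (deviation P j k v)
          + L2_inner 1 (iface P j) (deviation P j k v) (conormal_flux P k (v k))))"
    by (intro sum_mono iface_term)
  moreover have "(\<Sum>i\<in>surfs P. \<beta> * c * U i - (\<delta> * G i + U i / \<delta>))
      \<le> (\<Sum>i\<in>surfs P.
        L2_inner 1 (dir_part P i) (\<lambda>x. \<beta> * coeff P i x * inverse h * piece_trace P i (v i) x) (piece_trace P i (v i))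
        - L2_inner 1 (dir_part P i) (conormal_flux P i (v i)) (piece_trace P i (v i))
        - L2_inner 1 (dir_part P i) (piece_trace P i (v i)) (conormal_flux P i (v i)))"
    by (intro sum_mono dir_term)
  ultimately have "E' + (\<beta> * c * T' - (\<delta> * F' + T' / \<delta>)) \<le> A_form P \<beta> h s v v"
    unfolding A_form_def a_form_def sum_subtractf by linarith
  moreover have "\<delta> * F' \<le> E' / 2"
    using mult_left_mono[OF F'_le less_imp_le[OF \<delta>]] K(2) by (simp add: \<delta>_def)
  moreover have "T' / \<delta> + T' \<le> \<beta> * c * T'"
    using mult_right_mono[OF \<beta>_large T'_nonneg] K(2) by (simp add: \<delta>_def algebra_simps)
  ultimately have lower: "E' / 2 + T' \<le> A_form P \<beta> h s v v" by linarith

  have deriv: "h * (L2_norm 1 \<omega> (conormal_deriv P i (v i)))\<^sup>2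
      \<le> h * (L2_norm 1 \<omega> (conormal_flux P i (v i)))\<^sup>2 / c\<^sup>2"
    if i: "i \<in> surfs P" and \<omega>: "boundary_portion P c C i \<omega>" for i \<omega>
    using mult_left_mono[OF boundary_portion.deriv_le_flux[OF \<omega> ve[OF i]] less_imp_le[OF h]] c_pos
    by (simp add: field_simps)
  have "(\<Sum>j\<in>ifaces P. \<Sum>k\<in>sharing P j.
        h * (L2_norm 1 (iface P j) (conormal_deriv P k (v k)))\<^sup>2
      + inverse h * (L2_norm 1 (iface P j) (deviation P j k v))\<^sup>2)
    \<le> (\<Sum>j\<in>ifaces P. \<Sum>k\<in>sharing P j. F j k / c\<^sup>2 + T j k)"
    unfolding F_def T_def
    by (intro sum_mono add_mono deriv iface_portion order_refl) (auto dest: sharing_surfs)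
  moreover have "(\<Sum>i\<in>surfs P. h * (L2_norm 1 (dir_part P i) (conormal_deriv P i (v i)))\<^sup>2)
    \<le> (\<Sum>i\<in>surfs P. G i / c\<^sup>2)"
    unfolding G_def by (intro sum_mono deriv dir_portion)
  moreover have "(norm_s P s v)\<^sup>2 = s_form P s v v"
    unfolding norm_s_def s_form_def using s by (simp add: sum_nonneg)
  moreover have "(norm_A P h s v)\<^sup>2 = (norm_a P h v)\<^sup>2 + (norm_s P s v)\<^sup>2"
    unfolding norm_A_def by simp
  ultimately have "(norm_A P h s v)\<^sup>2 \<le> E' + F' / c\<^sup>2 + T'"
    unfolding norm_a_squared[OF h] E'_eq F'_def T'_def U_def
    by (simp add: sum_distrib_left sum.distrib sum_divide_distrib add_divide_distrib)
  also have "\<dots> \<le> E' + K * E' / c\<^sup>2 + T'"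
    using F'_le c_pos by (simp add: divide_right_mono)
  also have "\<dots> \<le> 2 * (1 + K / c\<^sup>2) * (E' / 2 + T')"
    using T'_nonneg K(2) c_pos by (simp add: field_simps)
  also have "\<dots> \<le> 2 * (1 + K / c\<^sup>2) * A_form P \<beta> h s v v"
    using lower K(2) by (intro mult_left_mono) auto
  finally show ?thesis .
qed

end

theorem lemma4p1:
  fixes P :: "('i, 'j) composite"
    and h\<^sub>0 :: real and p :: nat
    and \<K> :: "real \<Rightarrow> 'i \<Rightarrow> ('d::finite) element set"
    and V\<^sub>h :: "real \<Rightarrow> 'i \<Rightarrow> (real^3 \<Rightarrow> real) set"
    and s :: "real \<Rightarrow> 'i stabilization"
    and D :: "real \<Rightarrow> 'i \<Rightarrow> (real^3 \<Rightarrow> real) set"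
    and g\<^sub>D :: "real^3 \<Rightarrow> real"
  assumes surface: "composite_surface P"
    and coeff: "coefficient_bounds P"
    and weights: "convex_weights P"
    and h0: "0 < h\<^sub>0"
    and meshes: "\<And>i. i \<in> surfs P \<Longrightarrow>
          quasi_uniform_meshes (ambient P i) (piece P i) h\<^sub>0 (\<lambda>h. \<K> h i)"
    and spaces: "\<And>h i. h \<in> {0<..h\<^sub>0} \<Longrightarrow> i \<in> surfs P \<Longrightarrow>
          fe_space p (\<K> h i) (V\<^sub>h h i) \<and> V\<^sub>h h i \<subseteq> energy_space P i"
    and stab: "\<And>h i. h \<in> {0<..h\<^sub>0} \<Longrightarrow> i \<in> surfs P \<Longrightarrow>
          linear_space (D h i) \<and> V\<^sub>h h i \<subseteq> D h i \<and> psd_bilinear_form (D h i) (s h i)"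
    and inverse_inequality: "\<exists>C. \<forall>h\<in>{0<..h\<^sub>0}. \<forall>i\<in>surfs P. \<forall>v\<in>V\<^sub>h h i.
          h * (L2_norm 1 (bdry P i - neumann P) (conormal_flux P i v))\<^sup>2
            \<le> C * ((norm_a_piece P i v)\<^sup>2 + (norm_s_piece (s h) i v)\<^sup>2)"
  shows "(\<exists>\<beta>\<^sub>0>0. \<forall>\<beta>\<ge>\<beta>\<^sub>0. \<exists>c>0. \<forall>h\<in>{0<..h\<^sub>0}. \<forall>v\<in>broken_space P (V\<^sub>h h).
            (norm_A P h (s h) v)\<^sup>2 \<le> c * A_form P \<beta> h (s h) v v)
       \<and> (\<forall>\<beta>>0. \<exists>c>0. \<forall>h\<in>{0<..h\<^sub>0}.
            \<forall>v \<in> field_sum (broken_space P (V\<^sub>h h)) (solution_space P g\<^sub>D) \<inter> broken_space P (energy_space P).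
            \<forall>w \<in> field_sum (broken_space P (V\<^sub>h h)) (solution_space P g\<^sub>D) \<inter> broken_space P (energy_space P).
              a_form P \<beta> h v w \<le> c * norm_a P h v * norm_a P h w)
       \<and> (\<forall>\<beta>>0. \<exists>c>0. \<forall>h\<in>{0<..h\<^sub>0}.
            \<forall>v \<in> field_sum (broken_space P (V\<^sub>h h)) (solution_space P g\<^sub>D)
                  \<inter> broken_space P (energy_space P) \<inter> broken_space P (D h).
            \<forall>w \<in> field_sum (broken_space P (V\<^sub>h h)) (solution_space P g\<^sub>D)
                  \<inter> broken_space P (energy_space P) \<inter> broken_space P (D h).
              A_form P \<beta> h (s h) v w \<le> c * norm_A P h (s h) v * norm_A P h (s h) w)"
proof -
  obtain c C where "bounded_composite P c C"
    using bounded_composite_exists[OF surface coeff] by blast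
  then interpret bounded_composite P c C .
  \<comment> \<open>the given constant of the inverse inequality may be negative, so it is replaced by a larger one\<close>
  obtain K\<^sub>0 where K0: "0 \<le> K\<^sub>0" and inv: "\<And>h i v. h \<in> {0<..h\<^sub>0} \<Longrightarrow> i \<in> surfs P \<Longrightarrow> v \<in> V\<^sub>h h i \<Longrightarrow>
      h * (L2_norm 1 (bdry P i - neumann P) (conormal_flux P i v))\<^sup>2
        \<le> K\<^sub>0 * ((norm_a_piece P i v)\<^sup>2 + (norm_s_piece (s h) i v)\<^sup>2)"
  proof -
    obtain K1 where K1: "\<forall>h\<in>{0<..h\<^sub>0}. \<forall>i\<in>surfs P. \<forall>v\<in>V\<^sub>h h i.
          h * (L2_norm 1 (bdry P i - neumann P) (conormal_flux P i v))\<^sup>2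
            \<le> K1 * ((norm_a_piece P i v)\<^sup>2 + (norm_s_piece (s h) i v)\<^sup>2)"
      using inverse_inequality by blast
    show ?thesis
    proof (rule that[of "max K1 0"])
      fix h i v assume "h \<in> {0<..h\<^sub>0}" "i \<in> surfs P" "v \<in> V\<^sub>h h i"
      with K1 have "h * (L2_norm 1 (bdry P i - neumann P) (conormal_flux P i v))\<^sup>2
            \<le> K1 * ((norm_a_piece P i v)\<^sup>2 + (norm_s_piece (s h) i v)\<^sup>2)" by blast
      also have "\<dots> \<le> max K1 0 * ((norm_a_piece P i v)\<^sup>2 + (norm_s_piece (s h) i v)\<^sup>2)"
        by (intro mult_right_mono) auto
      finally show "h * (L2_norm 1 (bdry P i - neumann P) (conormal_flux P i v))\<^sup>2
            \<le> max K1 0 * ((norm_a_piece P i v)\<^sup>2 + (norm_s_piece (s h) i v)\<^sup>2)" .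
    qed simp
  qed
  \<comment> \<open>the summand \<open>1\<close> keeps \<open>K\<close> positive also if the inverse inequality holds with constant \<open>0\<close>\<close>
  define K where "K = real (iface_sides + card (surfs P)) * K\<^sub>0 + 1"
  have K: "0 < K" unfolding K_def using K0 by (simp add: add_nonneg_pos)
  have coercive: "(norm_A P h (s h) v)\<^sup>2 \<le> 2 * (1 + K / c\<^sup>2) * A_form P \<beta> h (s h) v v"
    if \<beta>: "(2 * K + 1) / c \<le> \<beta>" and h: "h \<in> {0<..h\<^sub>0}" and v: "v \<in> broken_space P (V\<^sub>h h)" for \<beta> h v
  proof (rule A_form_coercive[where K\<^sub>0 = K\<^sub>0])
    show "2 * K + 1 \<le> \<beta> * c" using \<beta> c_pos by (simp add: field_simps)
    show "0 < \<beta>" using \<beta> K c_pos by (smt (verit) divide_pos_pos)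
    show "v \<in> broken_space P (energy_space P)"
      using v spaces[OF h] unfolding broken_space_def by blast
    have vi: "v i \<in> V\<^sub>h h i" if "i \<in> surfs P" for i using v that unfolding broken_space_def by blast
    show sn: "0 \<le> s h i (v i) (v i)" if "i \<in> surfs P" for i
      using stab[OF h that] vi[OF that] unfolding psd_bilinear_form_def by blast
    show "h * (L2_norm 1 (bdry P i - neumann P) (conormal_flux P i (v i)))\<^sup>2
      \<le> K\<^sub>0 * ((norm_a_piece P i (v i))\<^sup>2 + s h i (v i) (v i))" if "i \<in> surfs P" for i
      using inv[OF h that vi[OF that]] sn[OF that] by (simp add: norm_s_piece_def)
  qed (use h K K0 in \<open>auto simp: K_def\<close>)
  define M where "M \<beta> = 2 * card (surfs P) + real (iface_sides + card (surfs P)) * (2 * C + \<beta> * C) + 1" for \<beta>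
  have M: "0 < M \<beta>" if "0 < \<beta>" for \<beta>
    unfolding M_def using that C_pos by (intro add_nonneg_pos add_nonneg_nonneg mult_nonneg_nonneg) auto
  have a_cont: "a_form P \<beta> h v w \<le> M \<beta> * norm_a P h v * norm_a P h w"
    if \<beta>: "0 < \<beta>" and h: "h \<in> {0<..h\<^sub>0}"
      and vw: "v \<in> broken_space P (energy_space P)" "w \<in> broken_space P (energy_space P)" for \<beta> h v w
  proof -
    have h': "0 < h" using h by simp
    have "a_form P \<beta> h v w \<le> (real (card (surfs P)) + real (iface_sides + card (surfs P)) * (2 * C + \<beta> * C))
        * (norm_a P h v * norm_a P h w)" by (rule a_form_continuous[OF h' \<beta> vw])
    also have "\<dots> \<le> M \<beta> * (norm_a P h v * norm_a P h w)"
      unfolding M_def by (intro mult_right_mono mult_nonneg_nonneg norm_a_nonneg h') auto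
    finally show ?thesis by (simp only: mult.assoc)
  qed
  have A_cont: "A_form P \<beta> h (s h) v w \<le> M \<beta> * norm_A P h (s h) v * norm_A P h (s h) w"
    if \<beta>: "0 < \<beta>" and h: "h \<in> {0<..h\<^sub>0}"
      and vw: "v \<in> broken_space P (energy_space P) \<inter> broken_space P (D h)"
        "w \<in> broken_space P (energy_space P) \<inter> broken_space P (D h)" for \<beta> h v w
  proof -
    have h': "0 < h" using h by simp
    have "A_form P \<beta> h (s h) v w \<le> (2 * card (surfs P) + real (iface_sides + card (surfs P)) * (2 * C + \<beta> * C))
        * (norm_A P h (s h) v * norm_A P h (s h) w)"
      using stab[OF h] by (intro A_form_continuous[OF h' \<beta> _ _ vw]) auto
    also have "\<dots> \<le> M \<beta> * (norm_A P h (s h) v * norm_A P h (s h) w)"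
      unfolding M_def by (intro mult_right_mono mult_nonneg_nonneg) (auto simp: norm_A_def)
    finally show ?thesis by (simp only: mult.assoc)
  qed
  have pos: "0 < (2 * K + 1) / c" "0 < 2 * (1 + K / c\<^sup>2)"
    using K c_pos by (auto intro!: divide_pos_pos add_pos_pos)
  show ?thesis
  proof (intro conjI)
    show "\<exists>\<beta>\<^sub>0>0. \<forall>\<beta>\<ge>\<beta>\<^sub>0. \<exists>c>0. \<forall>h\<in>{0<..h\<^sub>0}. \<forall>v\<in>broken_space P (V\<^sub>h h).
            (norm_A P h (s h) v)\<^sup>2 \<le> c * A_form P \<beta> h (s h) v v"
      using coercive pos by blast
  qed (intro allI impI, rule exI, rule conjI, erule M, intro ballI, (rule a_cont | rule A_cont); blast)+
qed

end
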